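(* Let $\mathcal{C}=\mathcal{A}\oplus\mathcal{B}$ be a gluing of geometric polytopal $d$-complexes such that $\mathcal{A}\cap\mathcal{B}$ is a disjoint union of closed polytopal $(d-1)$-complexes without boundary. Then $$\chi(\partial\mathcal{C})-\chi(\partial\mathcal{A})-\chi(\partial\mathcal{B})=2\left(\chi_\alpha(\mathcal{C})-\chi_\alpha(\mathcal{A})-\chi_\alpha(\mathcal{B})\right).$$ In particular, if $\mathcal{A}\cap\mathcal{B}$ is a union of $m$ disjoint $(d-1)$-spheres, then $$\chi(\partial\mathcal{C})=\chi(\partial\mathcal{A})+\chi(\partial\mathcal{B})-2m\left(1+(-1)^{d-1}\right)$$ and $$\chi_\alpha(\mathcal{C})=\chi_\alpha(\mathcal{A})+\chi_\alpha(\mathcal{B})-m\left(1+(-1)^{d-1}\right).$$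
   Context: A polytopal complex is a finite collection of convex polytopes, closed under taking faces, such that the intersection of any two members is a face of both. A geometric polytopal $d$-complex $\mathcal{C}$ is a polytopal complex that is connected, pure of dimension $d$, and embedded in $\mathbb{R}^d$ (its cells are actual convex polytopes in $\mathbb{R}^d$). $|\mathcal{C}|$ is the union of the cells, $\mathrm{int}(\mathcal{C})$ its $d$-dimensional interior, and $\partial\mathcal{C}$ the complex of boundary faces. For a nonempty $F\in\partial\mathcal{C}$, $\alpha(F,\mathcal{C})=\mathrm{vol}(S_\varepsilon(x)\cap\mathrm{int}(\mathcal{C}))/\mathrm{vol}(S_\varepsilon(x))$, with $x$ in the relative interior of $F$ and $S_\varepsilon(x)$ the $(d-1)$-sphere of radius $\varepsilon$ centered at $x$, $\varepsilon>0$ sufficiently small. For $0\le i\le d-1$, $\alpha_i(\mathcal{C})=\sum\alpha(F,\mathcal{C})$ over all $i$-faces $F$ of $\partial\mathcal{C}$; $\chi_\alpha(\mathcal{C})=\sum_{i=0}^{d-1}(-1)^i\alpha_i(\mathcal{C})$, and $\chi(\partial\mathcal{C})=\sum_{i=0}^{d-1}(-1)^if_i(\partial\mathcal{C})$ with $f_i$ the number of $i$-faces. A gluing $\mathcal{C}=\mathcal{A}\oplus\mathcal{B}$ means $\mathcal{C}=\mathcal{A}\cup\mathcal{B}$, where the $d$-complexes $\mathcal{A},\mathcal{B}$ meet exactly along a common subcomplex $\mathcal{A}\cap\mathcal{B}$ contained in both $\partial\mathcal{A}$ and $\partial\mathcal{B}$. $\mathrm{int}(\mathcal{A}\cap\mathcal{B})$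 is the set of points of $|\mathcal{A}\cap\mathcal{B}|$ contained in an open $(d-1)$-dimensional subset of $|\mathcal{A}\cap\mathcal{B}|$, and $\partial(\mathcal{A}\cap\mathcal{B})$ is its complement in $\mathcal{A}\cap\mathcal{B}$; "without boundary" means $\partial(\mathcal{A}\cap\mathcal{B})=\emptyset$.
   Formalization: "Without boundary" is taken to mean that every point of |A∩B| has a neighborhood in |∂A| and in |∂B| lying inside |A∩B|; if A∩B is only intrinsically a closed manifold, the formula fails, e.g. when a hole of A touches B in one vertex (d=2). *)

theory Defs
  imports "HOL-Analysis.Analysis"
begin

text \<open>
  Throughout, the ambient space \<open>\<real>\<^sup>d\<close> is a type of class \<^class>\<open>euclidean_space\<close> with
  \<open>d = DIM('a) \<ge> 1\<close>, and a complex is its set of cells. As \<open>{}\<close> counts as a face of every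
  polytope (\<^const>\<open>face_of\<close>), it belongs to every nonempty complex. Its affine dimension is
  \<open>-1\<close>, so it is never counted as an \<open>i\<close>-face.
\<close>

definition polytopal_complex :: "'a::euclidean_space set set \<Rightarrow> bool" where
  "polytopal_complex K \<longleftrightarrow>
     finite K \<and> (\<forall>P\<in>K. polytope P) \<and>
     (\<forall>P\<in>K. \<forall>F. F face_of P \<longrightarrow> F \<in> K) \<and>
     (\<forall>P\<in>K. \<forall>Q\<in>K. (P \<inter> Q) face_of P \<and> (P \<inter> Q) face_of Q)"

definition pure_complex :: "nat \<Rightarrow> 'a::euclidean_space set set \<Rightarrow> bool" where
  "pure_complex k K \<longleftrightarrow>
     polytopal_complex K \<and> K \<noteq> {} \<and> (\<forall>P\<in>K. \<exists>Q\<in>K. P face_of Q \<and> aff_dim Q = int k)"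

definition geometric_complex :: "'a::euclidean_space set set \<Rightarrow> bool" where
  "geometric_complex K \<longleftrightarrow> pure_complex DIM('a) K \<and> connected (\<Union>K)"

definition boundary_complex :: "'a::euclidean_space set set \<Rightarrow> 'a set set" where
  "boundary_complex K = {F\<in>K. F \<subseteq> frontier (\<Union>K)}"

definition faces_of_dim :: "nat \<Rightarrow> 'a::euclidean_space set set \<Rightarrow> 'a set set" where
  "faces_of_dim i K = {F\<in>K. aff_dim F = int i}"

text \<open>
  The \<open>(d-1)\<close>-dimensional volume of a subset \<open>T\<close> of the sphere \<open>S\<^sub>r(x)\<close>, as the usual cone
  measure: \<open>d / r\<close> times the Lebesgue measure of the cone over \<open>T\<close> with apex \<open>x\<close>. For
  \<open>T = S\<^sub>r(x)\<close> the cone is the ball of radius \<open>r\<close>, and \<open>d / r\<close> times its volume is the area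
  of the sphere; for \<open>d = 1\<close> this is counting measure on the two points of \<open>S\<^sub>r(x)\<close>.
\<close>

definition sphere_vol :: "'a::euclidean_space \<Rightarrow> real \<Rightarrow> 'a set \<Rightarrow> real" where
  "sphere_vol x r T =
     DIM('a) / r * measure lebesgue {x + t *\<^sub>R (y - x) | t y. 0 \<le> t \<and> t \<le> 1 \<and> y \<in> T}"

text \<open>
  The solid angle at \<open>F\<close>: the common value of the volume ratio for all points \<open>x\<close> in the relative
  interior of \<open>F\<close> and all sufficiently small radii.
\<close>

definition solid_angle :: "'a::euclidean_space set \<Rightarrow> 'a set set \<Rightarrow> real" where
  "solid_angle F K =
     (THE a. \<forall>x\<in>rel_interior F. \<forall>\<^sub>F \<epsilon> in at_right 0.
        sphere_vol x \<epsilon> (sphere x \<epsilon> \<inter> interior (\<Union>K)) / sphere_vol x \<epsilon> (sphere x \<epsilon>) = a)"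

definition angle_sum :: "nat \<Rightarrow> 'a::euclidean_space set set \<Rightarrow> real" where
  "angle_sum i K = (\<Sum>F\<in>faces_of_dim i (boundary_complex K). solid_angle F K)"

definition angle_char :: "'a::euclidean_space set set \<Rightarrow> real" where
  "angle_char K = (\<Sum>i<DIM('a). (-1) ^ i * angle_sum i K)"

text \<open>
  The sum stops at \<open>d - 1\<close>; the function is meant for boundary complexes, which have no
  \<open>d\<close>-cells.
\<close>

definition euler_char :: "'a::euclidean_space set set \<Rightarrow> int" where
  "euler_char K = (\<Sum>i<DIM('a). (-1) ^ i * int (card (faces_of_dim i K)))"

definition gluing ::
  "'a::euclidean_space set set \<Rightarrow> 'a set set \<Rightarrow> 'a set set \<Rightarrow> bool" where
  "gluing C A B \<longleftrightarrow>
     geometric_complex A \<and> geometric_complex B \<and> geometric_complex C \<and>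
     C = A \<union> B \<and> \<Union>A \<inter> \<Union>B = \<Union>(A \<inter> B) \<and>
     A \<inter> B \<subseteq> boundary_complex A \<and> A \<inter> B \<subseteq> boundary_complex B"

text \<open>
  The points of \<open>|A \<inter> B|\<close> that lie in an open \<open>(d-1)\<close>-dimensional subset \<open>U\<close> of \<open>|A \<inter> B|\<close>. Here
  ``open'' refers to the two \<open>(d-1)\<close>-dimensional boundaries in which \<open>A \<inter> B\<close> lies, as the
  \<open>d\<close>-dimensional interior of a complex refers to \<open>\<real>\<^sup>d\<close>; openness in \<open>|A \<inter> B|\<close> itself would
  always be satisfied by \<open>U = |A \<inter> B|\<close>. As \<open>U\<close> is open, it has dimension \<open>d - 1\<close> as soon as it
  meets the relative interior of a \<open>(d-1)\<close>-cell.

  It does not suffice that \<open>|A \<inter> B|\<close> is intrinsically a closed manifold. For \<open>d = 2\<close> let \<open>B\<close> be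
  a square in the interior of a larger square \<open>Q\<close>, and let \<open>A\<close> subdivide the closure of \<open>Q - B\<close>
  minus a small triangle that touches \<open>B\<close> in exactly one vertex of both. Then \<open>|A \<inter> B|\<close> is a
  circle, but that vertex remains on the boundary of \<open>A \<union> B\<close>, and the Euler characteristics of the
  boundaries of \<open>A\<close>, \<open>B\<close> and \<open>A \<union> B\<close> are \<open>-1\<close>, \<open>0\<close> and \<open>0\<close>.
\<close>

definition gluing_interior ::
  "'a::euclidean_space set set \<Rightarrow> 'a set set \<Rightarrow> 'a set" where
  "gluing_interior A B =
     {x \<in> \<Union>(A \<inter> B). \<exists>U. x \<in> U \<and> U \<subseteq> \<Union>(A \<inter> B) \<and>
        openin (top_of_set (\<Union>(boundary_complex A))) U \<and>
        openin (top_of_set (\<Union>(boundary_complex B))) U \<and>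
        (\<exists>P\<in>faces_of_dim (DIM('a) - 1) (A \<inter> B). U \<inter> rel_interior P \<noteq> {})}"

definition gluing_boundary ::
  "'a::euclidean_space set set \<Rightarrow> 'a set set \<Rightarrow> 'a set" where
  "gluing_boundary A B = \<Union>(A \<inter> B) - gluing_interior A B"

text \<open>Disjointness is that of the underlying point sets, as the complexes all share the cell \<open>{}\<close>.\<close>

definition disjoint_union_of_complexes ::
  "'a::euclidean_space set set \<Rightarrow> 'a set set set \<Rightarrow> bool" where
  "disjoint_union_of_complexes S \<D> \<longleftrightarrow>
     finite \<D> \<and> S = \<Union>\<D> \<and> (\<forall>D\<in>\<D>. pure_complex (DIM('a) - 1) D) \<and>
     pairwise (\<lambda>D E. \<Union>D \<inter> \<Union>E = {}) \<D>"

definition union_of_disjoint_spheres ::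
  "nat \<Rightarrow> 'a::euclidean_space set set \<Rightarrow> bool" where
  "union_of_disjoint_spheres m S \<longleftrightarrow>
     (\<exists>\<D>. disjoint_union_of_complexes S \<D> \<and> card \<D> = m \<and>
        (\<forall>D\<in>\<D>. \<Union>D homeomorphic sphere (0::'a) 1))"

end

theory Submission
  imports Defs "HOL-Homology.Homology"
begin

text \<open>
  Around the relative interior of a nonempty cell of \<open>A\<close> outside \<open>B\<close> the complexes \<open>A\<close> and \<open>C\<close>
  agree, so the cell contributes the same to \<open>A\<close> and to \<open>C\<close>. A nonempty cell of \<open>A \<inter> B\<close>
  lies in the interior of \<open>\<Union>C\<close>, because \<open>A \<inter> B\<close> has no boundary, and its solid angles in \<open>A\<close> and \<open>B\<close>
  add up to \<open>1\<close>. Hence \<open>\<chi>(\<partial>C) - \<chi>(\<partial>A) - \<chi>(\<partial>B) = - 2 \<chi>(A \<inter> B)\<close>, whereas the difference of the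
  angle characteristics is \<open>- \<chi>(A \<inter> B)\<close>.

  For spheres, \<open>\<chi>\<close> is computed from singular homology. Attaching a cell \<open>P\<close> of top dimension to the
  union \<open>X\<close> of the other cells changes the alternating sum of the ranks by \<open>\<plusminus>1\<close>. This follows from
  the long exact sequence of \<open>(X \<union> P, X \<union> P - {c})\<close> with \<open>c\<close> in the relative interior of \<open>P\<close>. By
  excision its relative groups are those of \<open>(P, P - {c})\<close>, and \<open>X \<union> P - {c}\<close> retracts to \<open>X\<close>.
\<close>

section \<open>Ranks of abelian groups\<close>

text \<open>Two obstacles shape the argument. A gluing without boundary only tells that, near a
  point of \<open>\<Union>(A \<inter> B)\<close>, the frontiers of \<open>\<Union>A\<close> and
  \<open>\<Union>B\<close> are both contained in \<open>\<Union>(A \<inter> B)\<close>. That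
  \<open>\<Union>A\<close> and \<open>\<Union>B\<close> together fill a neighbourhood has to be
  deduced, from purity and from the fact that a set of codimension two cannot separate a ball.

  The other obstacle is torsion. The relative group of an attached cell is infinite cyclic, but its
  generator may have a boundary that is a nonzero torsion class. Then some multiple of the cell
  closes to a cycle while the cell itself does not, and the integral sequence does not split into
  two clean cases. Rational-valued additive functions do not see torsion, so in rank the cell either
  creates a class in its own degree \<open>n\<close> or kills one in degree \<open>n - 1\<close>;
  both change the alternating sum by \<open>(-1) ^ n\<close>.

  The constant \<open>1 + (-1) ^ (d - 1)\<close> comes from the two classes of a sphere of dimension
  \<open>d - 1\<close>, in degrees \<open>0\<close> and \<open>d - 1\<close>; for
  \<open>d = 1\<close> it counts two points.\<close>

definition additive_on :: "('g, 'm) monoid_scheme \<Rightarrow> ('g \<Rightarrow> rat) \<Rightarrow> bool" where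
  "additive_on G f \<longleftrightarrow> (\<forall>x\<in>carrier G. \<forall>y\<in>carrier G. f (x \<otimes>\<^bsub>G\<^esub> y) = f x + f y)"

text \<open>The function \<open>f\<close> plays the role of coordinates on \<open>G \<otimes> \<rat>\<close> with index set \<open>I\<close>. Its kernel is the
  torsion of \<open>G\<close>, and up to nonzero factors the unit vectors are in its image.\<close>

definition rank_witness ::
  "('g, 'm) monoid_scheme \<Rightarrow> nat set \<Rightarrow> ('g \<Rightarrow> nat \<Rightarrow> rat) \<Rightarrow> bool" where
  "rank_witness G I f \<longleftrightarrow>
     finite I \<and> (\<forall>i. additive_on G (\<lambda>x. f x i)) \<and>
     (\<forall>x\<in>carrier G. \<forall>i. i \<notin> I \<longrightarrow> f x i = 0) \<and>
     (\<forall>x\<in>carrier G. (\<forall>i. f x i = 0) \<longrightarrow> (\<exists>n::nat. n > 0 \<and> x [^]\<^bsub>G\<^esub> n = \<one>\<^bsub>G\<^esub>)) \<and>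
     (\<forall>j\<in>I. \<exists>b\<in>carrier G. f b j \<noteq> 0 \<and> (\<forall>i. i \<noteq> j \<longrightarrow> f b i = 0))"

text \<open>A relation in \<open>k\<close>: witnesses can be transported along exact sequences one
  at a time. Uniqueness of \<open>k\<close> is established for the trivial group and for
  \<open>integer_group\<close>, the groups met in the homology of spheres of positive
  dimension.\<close>

definition has_rank :: "('g, 'm) monoid_scheme \<Rightarrow> nat \<Rightarrow> bool" where
  "has_rank G k \<longleftrightarrow> (\<exists>I f. rank_witness G I f \<and> card I = k)"

lemma rank_witnessD:
  assumes "rank_witness G I f"
  shows "finite I" "\<And>i. additive_on G (\<lambda>x. f x i)"
    "\<And>x i. x \<in> carrier G \<Longrightarrow> i \<notin> I \<Longrightarrow> f x i = 0"
    "\<And>x. x \<in> carrier G \<Longrightarrow> (\<And>i. f x i = 0) \<Longrightarrow> \<exists>n::nat. n > 0 \<and> x [^]\<^bsub>G\<^esub> n = \<one>\<^bsub>G\<^esub>"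
    "\<And>j. j \<in> I \<Longrightarrow> \<exists>b\<in>carrier G. f b j \<noteq> 0 \<and> (\<forall>i. i \<noteq> j \<longrightarrow> f b i = 0)"
  using assms unfolding rank_witness_def by blast+

context group begin

lemma additive_on_one: "additive_on G f \<Longrightarrow> f \<one> = 0"
  unfolding additive_on_def by (metis add_cancel_right_right one_closed r_one)

lemma additive_on_inv: "additive_on G f \<Longrightarrow> x \<in> carrier G \<Longrightarrow> f (inv x) = - f x"
  using additive_on_one[of f] unfolding additive_on_def
  by (metis add.commute add_eq_0_iff inv_closed l_inv)

lemma additive_on_nat_pow:
  "additive_on G f \<Longrightarrow> x \<in> carrier G \<Longrightarrow> f (x [^] (n::nat)) = of_nat n * f x"
proof (induction n)
  case 0
  then show ?case by (simp add: additive_on_one)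
next
  case (Suc n)
  then have "f (x [^] n \<otimes> x) = f (x [^] n) + f x"
    unfolding additive_on_def by blast
  with Suc show ?case by (simp add: algebra_simps)
qed

lemma additive_on_int_pow:
  assumes "additive_on G f" "x \<in> carrier G"
  shows "f (x [^] (n::int)) = of_int n * f x"
proof (cases "n \<ge> 0")
  case True
  then obtain m where "n = int m" using nonneg_int_cases by blast
  then show ?thesis using additive_on_nat_pow[OF assms, of m] by (simp add: int_pow_int)
next
  case False
  then obtain m where m: "n = - int m" by (metis linear nonneg_int_cases neg_0_le_iff_le minus_minus)
  have "x [^] n = inv (x [^] m)" using m assms int_pow_neg_int by blast
  then show ?thesis using additive_on_nat_pow[OF assms, of m] additive_on_inv[OF assms(1), of "x [^] m"] assms
    by (simp add: m)
qed

lemma torsion_int_pow: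
  assumes "x \<in> carrier G" "x [^] (k::int) = \<one>" "k \<noteq> 0"
  shows "\<exists>n::nat. n > 0 \<and> x [^] n = \<one>"
proof (cases "k > 0")
  case True
  then show ?thesis using assms by (metis int_pow_int pos_int_cases)
next
  case False
  then have "x [^] (-k) = \<one>" "- k > 0"
    using assms by (auto simp: int_pow_neg)
  then show ?thesis by (metis int_pow_int pos_int_cases)
qed

end

lemma rank_witness_iso:
  assumes "group G" "group H" "h \<in> iso H G" "rank_witness G I f"
  shows "rank_witness H I (f \<circ> h)"
proof -
  interpret G: group G by fact
  interpret H: group H by fact
  have hom: "h \<in> hom H G" and bij: "bij_betw h (carrier H) (carrier G)"
    using assms(3) by (auto simp: iso_def)
  interpret h: group_hom H G h using hom by unfold_locales
  have surj: "\<exists>a\<in>carrier H. h a = b" if "b \<in> carrier G" for b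
    using that bij by (metis bij_betw_imp_surj_on image_iff)
  have tor: "x [^]\<^bsub>H\<^esub> n = \<one>\<^bsub>H\<^esub>" if "x \<in> carrier H" "h x [^]\<^bsub>G\<^esub> n = \<one>\<^bsub>G\<^esub>" for x and n :: nat
    using that bij h.hom_nat_pow[of x n] h.hom_one H.nat_pow_closed H.one_closed
    by (metis bij_betw_inv_into_left)
  show ?thesis
    unfolding rank_witness_def o_def
  proof (intro conjI ballI allI impI)
    show "finite I" using assms(4) by (simp add: rank_witness_def)
    show "additive_on H (\<lambda>x. f (h x) i)" for i
      using assms(4) by (simp add: rank_witness_def additive_on_def)
    show "f (h x) i = 0" if "x \<in> carrier H" "i \<notin> I" for x i
      using assms(4) that by (simp add: rank_witness_def)
    show "\<exists>n::nat. n > 0 \<and> x [^]\<^bsub>H\<^esub> n = \<one>\<^bsub>H\<^esub>" if "x \<in> carrier H" "\<forall>i. f (h x) i = 0" for x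
      using rank_witnessD(4)[OF assms(4), of "h x"] that tor by auto
    show "\<exists>b\<in>carrier H. f (h b) j \<noteq> 0 \<and> (\<forall>i. i \<noteq> j \<longrightarrow> f (h b) i = 0)" if j: "j \<in> I" for j
    proof -
      obtain b where "b \<in> carrier G" "f b j \<noteq> 0 \<and> (\<forall>i. i \<noteq> j \<longrightarrow> f b i = 0)"
        using rank_witnessD(5)[OF assms(4) j] by blast
      then show ?thesis using surj by blast
    qed
  qed
qed

lemma has_rank_iso:
  assumes "group G" "group H" "G \<cong> H" "has_rank G k"
  shows "has_rank H k"
proof -
  have "H \<cong> G" using assms group.iso_sym by blast
  then obtain h where "h \<in> iso H G" by (auto simp: is_iso_def)
  then show ?thesis using rank_witness_iso[OF assms(1,2)] assms(4) unfolding has_rank_def by blast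
qed

lemma has_rank_trivial:
  assumes "group G" "trivial_group G"
  shows "has_rank G 0"
proof -
  interpret group G by fact
  have "carrier G = {\<one>\<^bsub>G\<^esub>}" using assms(2) by (simp add: trivial_group_def singleton_group_def)
  then show ?thesis unfolding has_rank_def
    by (intro exI[of _ "{}"] exI[of _ "\<lambda>_ _. 0"])
       (auto simp: rank_witness_def additive_on_def intro!: exI[of _ "1::nat"])
qed

lemma has_rank_unique_trivial:
  assumes "group G" "trivial_group G" "has_rank G k"
  shows "k = 0"
proof -
  interpret group G by fact
  have c: "carrier G = {\<one>\<^bsub>G\<^esub>}" using assms(2) by (simp add: trivial_group_def)
  obtain I f where "rank_witness G I f" "card I = k" using assms(3) by (auto simp: has_rank_def)
  then show ?thesis using c additive_on_one rank_witnessD(2,5)[of G I f]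
    by (metis card.empty ex_in_conv singletonD)
qed

text \<open>Every coordinate is a multiple of the inclusion into the rationals, so no element can
  separate two indices, while an empty index set would make \<open>1\<close> a torsion
  element.\<close>

lemma has_rank_unique_integer:
  assumes "group G" "G \<cong> integer_group" "has_rank G k"
  shows "k = 1"
proof -
  have "has_rank integer_group k" using has_rank_iso assms group_integer_group by blast
  then obtain I f where w: "rank_witness integer_group I f" "card I = k" by (auto simp: has_rank_def)
  have f: "f n i = of_int n * f 1 i" for n i
  proof -
    have "additive_on integer_group (\<lambda>x. f x i)" using w by (auto simp: rank_witness_def)
    from group.additive_on_int_pow[OF group_integer_group this, of 1 n] show ?thesis by simp
  qed
  have sub: "i = j" if "i \<in> I" "j \<in> I" for i j
  proof (rule ccontr)
    assume ne: "i \<noteq> j"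
    obtain b where b: "f b j \<noteq> 0" "f b i = 0" using rank_witnessD(5)[OF w(1) \<open>j \<in> I\<close>] ne by blast
    obtain c where c: "f c i \<noteq> 0" using rank_witnessD(5)[OF w(1) \<open>i \<in> I\<close>] by blast
    show False using b c f[of b i] f[of b j] f[of c i] by auto
  qed
  have "I \<noteq> {}"
  proof
    assume "I = {}"
    then have "\<exists>n>0. 1 [^]\<^bsub>integer_group\<^esub> (n::nat) = \<one>\<^bsub>integer_group\<^esub>"
      using rank_witnessD(3,4)[OF w(1), of 1] by auto
    then show False by auto
  qed
  then obtain i where "I = {i}" using sub by blast
  with w show ?thesis by simp
qed

section \<open>Ranks of quotients by cyclic subgroups and of extensions by the integers\<close>

text \<open>Coordinates vanishing at \<open>g\<close> vanish on the cyclic kernel and therefore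
  factor through \<open>\<delta>\<close>. The torsion hypothesis asks only for a power in the
  kernel, because such an element becomes torsion in \<open>N\<close>.\<close>

lemma rank_witness_descend:
  fixes f :: "'g \<Rightarrow> nat \<Rightarrow> rat"
  assumes "group_hom M N \<delta>" "comm_group M" and surj: "\<delta> ` carrier M = carrier N"
    and ker: "kernel M N \<delta> = range (\<lambda>k::int. g [^]\<^bsub>M\<^esub> k)"
    and g: "g \<in> carrier M"
    and fin: "finite I" and add: "\<And>i. additive_on M (\<lambda>x. f x i)"
    and supp: "\<And>x i. x \<in> carrier M \<Longrightarrow> i \<notin> I \<Longrightarrow> f x i = 0"
    and fg: "\<And>i. f g i = 0"
    and tor: "\<And>x. x \<in> carrier M \<Longrightarrow> (\<And>i. f x i = 0) \<Longrightarrow> \<exists>n::nat. n > 0 \<and> x [^]\<^bsub>M\<^esub> n \<in> kernel M N \<delta>"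
    and span: "\<And>j. j \<in> I \<Longrightarrow> \<exists>b\<in>carrier M. f b j \<noteq> 0 \<and> (\<forall>i. i \<noteq> j \<longrightarrow> f b i = 0)"
  shows "has_rank N (card I)"
proof -
  interpret M: comm_group M by fact
  interpret \<delta>: group_hom M N \<delta> by fact
  \<comment> \<open>The value at an arbitrary preimage; two preimages differ by a power of
    \<open>g\<close>, on which \<open>f\<close> is zero.\<close>
  define F where "F y = f (SOME x. x \<in> carrier M \<and> \<delta> x = y)" for y
  have F: "F (\<delta> x) = f x" if x: "x \<in> carrier M" for x
  proof -
    define x' where "x' = (SOME x'. x' \<in> carrier M \<and> \<delta> x' = \<delta> x)"
    have x': "x' \<in> carrier M" "\<delta> x' = \<delta> x"
      unfolding x'_def by (rule someI2[of _ x]; use x in simp)+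
    have "x' \<otimes>\<^bsub>M\<^esub> inv\<^bsub>M\<^esub> x \<in> kernel M N \<delta>"
      using x x' by (simp add: kernel_def)
    then obtain k :: int where k: "x' \<otimes>\<^bsub>M\<^esub> inv\<^bsub>M\<^esub> x = g [^]\<^bsub>M\<^esub> k" using ker by auto
    have "f (x' \<otimes>\<^bsub>M\<^esub> inv\<^bsub>M\<^esub> x) i = 0" for i
      using M.additive_on_int_pow[OF add[of i] g, of k] fg k by simp
    moreover have "f (x' \<otimes>\<^bsub>M\<^esub> inv\<^bsub>M\<^esub> x) i = f x' i - f x i" for i
      using add[of i] M.additive_on_inv[OF add[of i] x] x x' unfolding additive_on_def by simp
    ultimately show ?thesis unfolding F_def x'_def[symmetric] by (intro ext) simp
  qed
  have ex: "\<exists>x\<in>carrier M. y = \<delta> x" if "y \<in> carrier N" for y using surj that by auto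
  have "rank_witness N I F"
    unfolding rank_witness_def
  proof (intro conjI ballI allI impI fin)
    show "additive_on N (\<lambda>x. F x i)" for i
      unfolding additive_on_def
    proof (intro ballI)
      fix x y assume "x \<in> carrier N" "y \<in> carrier N"
      then obtain a b where ab: "a \<in> carrier M" "b \<in> carrier M" "x = \<delta> a" "y = \<delta> b" using ex by metis
      then have "F (x \<otimes>\<^bsub>N\<^esub> y) i = f (a \<otimes>\<^bsub>M\<^esub> b) i" using F[of "a \<otimes>\<^bsub>M\<^esub> b"] by simp
      then show "F (x \<otimes>\<^bsub>N\<^esub> y) i = F x i + F y i"
        using ab add[of i] F unfolding additive_on_def by simp
    qed
    show "F x i = 0" if "x \<in> carrier N" "i \<notin> I" for x i
      using ex[OF that(1)] F supp that by auto
    show "\<exists>n::nat. n > 0 \<and> x [^]\<^bsub>N\<^esub> n = \<one>\<^bsub>N\<^esub>" if x: "x \<in> carrier N" and F0: "\<forall>i. F x i = 0" for x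
    proof -
      obtain a where a: "a \<in> carrier M" "x = \<delta> a" using ex[OF x] by blast
      then obtain n :: nat where "n > 0" "a [^]\<^bsub>M\<^esub> n \<in> kernel M N \<delta>" using tor[of a] F0 F by auto
      then show ?thesis using a \<delta>.hom_nat_pow[of a n] by (auto simp: kernel_def intro!: exI[of _ n])
    qed
    show "\<exists>b\<in>carrier N. F b j \<noteq> 0 \<and> (\<forall>i. i \<noteq> j \<longrightarrow> F b i = 0)" if "j \<in> I" for j
      using span[OF that] F by (metis \<delta>.hom_closed)
  qed
  then show ?thesis by (auto simp: has_rank_def)
qed

text \<open>A rational coordinate is zero on torsion, so a witness for \<open>M\<close> descends
  unchanged.\<close>

lemma has_rank_quotient_torsion:
  assumes "group_hom M N \<delta>" "comm_group M" "\<delta> ` carrier M = carrier N"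
    and ker: "kernel M N \<delta> = range (\<lambda>k::int. g [^]\<^bsub>M\<^esub> k)"
    and g: "g \<in> carrier M" and n: "g [^]\<^bsub>M\<^esub> (n::nat) = \<one>\<^bsub>M\<^esub>" "n > 0"
    and "has_rank M k"
  shows "has_rank N k"
proof -
  interpret \<delta>: group_hom M N \<delta> by fact
  obtain I f where w: "rank_witness M I f" "card I = k" using assms by (auto simp: has_rank_def)
  have fg: "f g i = 0" for i
  proof -
    have add: "additive_on M (\<lambda>x. f x i)" using w by (auto simp: rank_witness_def)
    show ?thesis using \<delta>.G.additive_on_nat_pow[OF add g, of n] n \<delta>.G.additive_on_one[OF add] by simp
  qed
  have "\<one>\<^bsub>M\<^esub> \<in> kernel M N \<delta>" by (simp add: kernel_def)
  then have "has_rank N (card I)"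
    using rank_witnessD[OF w(1)] fg by (intro rank_witness_descend[OF assms(1-5), of I f]) (simp, simp, simp, simp, metis, simp)
  then show ?thesis using w by simp
qed

text \<open>Some coordinate \<open>j\<close> is nonzero at \<open>g\<close>. Projecting along
  \<open>g\<close> onto the coordinates other than \<open>j\<close> gives a witness that descends
  and has lost exactly one index.\<close>

lemma has_rank_quotient_infinite:
  assumes "group_hom M N \<delta>" "comm_group M" "\<delta> ` carrier M = carrier N"
    and ker: "kernel M N \<delta> = range (\<lambda>k::int. g [^]\<^bsub>M\<^esub> k)"
    and g: "g \<in> carrier M" and inf: "\<And>n::nat. n > 0 \<Longrightarrow> g [^]\<^bsub>M\<^esub> n \<noteq> \<one>\<^bsub>M\<^esub>"
    and "has_rank M k"
  shows "k > 0 \<and> has_rank N (k - 1)"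
proof -
  interpret M: comm_group M by fact
  interpret \<delta>: group_hom M N \<delta> by fact
  obtain I f where w: "rank_witness M I f" "card I = k" using assms by (auto simp: has_rank_def)
  have add: "additive_on M (\<lambda>x. f x i)" for i using w by (auto simp: rank_witness_def)
  obtain j where j: "f g j \<noteq> 0" using rank_witnessD(4)[OF w(1) g] inf by blast
  then have jI: "j \<in> I" using rank_witnessD(3)[OF w(1) g] by blast
  \<comment> \<open>Subtracts the rational multiple of \<open>g\<close> that clears coordinate
    \<open>j\<close>; hence \<open>F g\<close> is zero.\<close>
  define F where "F x i = f x i - f g i / f g j * f x j" for x i
  have "has_rank N (card (I - {j}))"
  proof (rule rank_witness_descend[OF assms(1-5), of "I - {j}" F])
    show "finite (I - {j})" using w by (auto simp: rank_witness_def)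
    show "additive_on M (\<lambda>x. F x i)" for i
      using add[of i] add[of j] unfolding additive_on_def F_def
      by (simp add: algebra_simps add_divide_distrib)
    show "F x i = 0" if "x \<in> carrier M" "i \<notin> I - {j}" for x i
      using rank_witnessD(3)[OF w(1)] that j g unfolding F_def by (cases "i = j") auto
    show "F g i = 0" for i using j by (simp add: F_def)
    show "\<exists>n::nat. n > 0 \<and> x [^]\<^bsub>M\<^esub> n \<in> kernel M N \<delta>" if x: "x \<in> carrier M" and F0: "\<And>i. F x i = 0" for x
    proof -
      \<comment> \<open>If \<open>F x\<close> is zero, the coordinates of \<open>x\<close> are
        \<open>p / q\<close> times those of \<open>g\<close>. Clearing the denominator,
        \<open>q\<close> times \<open>x\<close> minus \<open>p\<close> times \<open>g\<close>
        (written multiplicatively) has zero coordinates and is torsion.\<close>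
      obtain p q :: int where pq: "f x j / f g j = of_int p / of_int q" "q > 0"
        by (metis Fract_of_int_quotient Rat_cases)
      define y where "y = x [^]\<^bsub>M\<^esub> q \<otimes>\<^bsub>M\<^esub> g [^]\<^bsub>M\<^esub> (-p)"
      have y: "y \<in> carrier M" using x g by (simp add: y_def)
      have "f y i = 0" for i
      proof -
        have "f y i = of_int q * f x i + of_int (- p) * f g i"
          using add[of i] x g M.additive_on_int_pow[OF add[of i]] unfolding y_def additive_on_def
          by (metis M.int_pow_closed)
        moreover have "f x i = f g i * (f x j / f g j)" using F0[of i] by (simp add: F_def)
        ultimately show ?thesis using pq by simp
      qed
      then obtain n :: nat where n: "n > 0" "y [^]\<^bsub>M\<^esub> n = \<one>\<^bsub>M\<^esub>"
        using rank_witnessD(4)[OF w(1) y] by blast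
      have "y [^]\<^bsub>M\<^esub> n = (x [^]\<^bsub>M\<^esub> (q * int n)) \<otimes>\<^bsub>M\<^esub> (g [^]\<^bsub>M\<^esub> (- p * int n))"
        using x g M.int_pow_distrib[of "x [^]\<^bsub>M\<^esub> q" "g [^]\<^bsub>M\<^esub> (- p)" "int n"]
        unfolding y_def by (simp add: M.int_pow_pow flip: int_pow_int)
      then have "x [^]\<^bsub>M\<^esub> (q * int n) = inv\<^bsub>M\<^esub> (g [^]\<^bsub>M\<^esub> (- p * int n))"
        using n x g by (metis M.int_pow_closed M.inv_equality)
      then have "x [^]\<^bsub>M\<^esub> (q * int n) = g [^]\<^bsub>M\<^esub> (p * int n)"
        using g by (metis M.int_pow_neg minus_mult_left M.inv_inv M.int_pow_closed)
      moreover have "q * int n = int (nat q * n)" using pq by simp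
      ultimately have "x [^]\<^bsub>M\<^esub> (nat q * n) = g [^]\<^bsub>M\<^esub> (p * int n)" by (metis int_pow_int)
      then show ?thesis using ker n pq by (intro exI[of _ "nat q * n"]) auto
    qed
    show "\<exists>b\<in>carrier M. F b i \<noteq> 0 \<and> (\<forall>l. l \<noteq> i \<longrightarrow> F b l = 0)" if i: "i \<in> I - {j}" for i
    proof -
      obtain b where "b\<in>carrier M" "f b i \<noteq> 0" "\<forall>l. l \<noteq> i \<longrightarrow> f b l = 0"
        using rank_witnessD(5)[OF w(1)] i by blast
      then show ?thesis using i by (intro bexI[of _ b]) (auto simp: F_def)
    qed
  qed
  moreover have "finite I" using w by (auto simp: rank_witness_def)
  ultimately show ?thesis using jI w(2) by (auto simp: card_gt_0_iff)
qed

text \<open>With \<open>n = h s\<close>, the element \<open>x [^] n \<otimes> s [^] (- h x)\<close> lies in the image of \<open>M\<close>. So the rational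
  coordinates of \<open>M\<close> extend to \<open>N\<close>, up to the factor \<open>n\<close>, although \<open>h\<close> need not be onto.\<close>

lemma has_rank_extension:
  assumes "group_hom M N \<alpha>" "comm_group M" "comm_group N" and inj: "inj_on \<alpha> (carrier M)"
    and hadd: "\<And>x y. x \<in> carrier N \<Longrightarrow> y \<in> carrier N \<Longrightarrow> h (x \<otimes>\<^bsub>N\<^esub> y) = h x + h y"
    and ker: "\<alpha> ` carrier M = {x \<in> carrier N. h x = (0::int)}"
    and s: "s \<in> carrier N" "h s > 0" and "has_rank M k"
  shows "has_rank N (Suc k)"
proof -
  interpret M: comm_group M by fact
  interpret N: comm_group N by fact
  interpret \<alpha>: group_hom M N \<alpha> by fact
  obtain I f where w: "rank_witness M I f" "card I = k" using assms by (auto simp: has_rank_def)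
  have finI: "finite I" using w by (auto simp: rank_witness_def)
  \<comment> \<open>A fresh index, reserved for the new coordinate \<open>h\<close>.\<close>
  then obtain l where l: "l \<notin> I" using ex_new_if_finite infinite_UNIV_nat by blast
  have add: "additive_on M (\<lambda>x. f x i)" for i using w by (auto simp: rank_witness_def)
  have haddq: "additive_on N (\<lambda>x. of_int (h x))" using hadd by (simp add: additive_on_def)
  have hpow: "h (x [^]\<^bsub>N\<^esub> j) = j * h x" if "x \<in> carrier N" for x and j :: int
    using N.additive_on_int_pow[OF haddq that, of j] by (metis of_int_eq_iff of_int_mult)
  define n where "n = h s"
  define c where "c x = x [^]\<^bsub>N\<^esub> n \<otimes>\<^bsub>N\<^esub> s [^]\<^bsub>N\<^esub> (- h x)" for x
  have c: "c x \<in> \<alpha> ` carrier M" if "x \<in> carrier N" for x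
    unfolding ker using that s by (simp add: c_def hadd hpow n_def)
  have cN: "c x \<in> carrier N" if "x \<in> carrier N" for x using c[OF that] ker by auto
  have cadd: "c (x \<otimes>\<^bsub>N\<^esub> y) = c x \<otimes>\<^bsub>N\<^esub> c y" if "x \<in> carrier N" "y \<in> carrier N" for x y
  proof -
    have "s [^]\<^bsub>N\<^esub> (- h x - h y) = s [^]\<^bsub>N\<^esub> (- h x) \<otimes>\<^bsub>N\<^esub> s [^]\<^bsub>N\<^esub> (- h y)"
      using N.int_pow_mult[OF s(1), of "- h x" "- h y"] by simp
    then show ?thesis
      using that s unfolding c_def by (simp add: hadd N.int_pow_distrib N.m_ac)
  qed
  define \<beta> where "\<beta> = inv_into (carrier M) \<alpha>"
  have \<beta>: "\<beta> y \<in> carrier M" "\<alpha> (\<beta> y) = y" if "y \<in> \<alpha> ` carrier M" for y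
    using that by (auto simp: \<beta>_def inv_into_into f_inv_into_f)
  have \<beta>\<alpha>: "\<beta> (\<alpha> x) = x" if "x \<in> carrier M" for x using inj that by (simp add: \<beta>_def)
  have \<beta>add: "\<beta> (x \<otimes>\<^bsub>N\<^esub> y) = \<beta> x \<otimes>\<^bsub>M\<^esub> \<beta> y" if xy: "x \<in> \<alpha> ` carrier M" "y \<in> \<alpha> ` carrier M" for x y
    using \<beta>[OF xy(1)] \<beta>[OF xy(2)] \<beta>\<alpha>[of "\<beta> x \<otimes>\<^bsub>M\<^esub> \<beta> y"] by simp
  define F where "F x i = (if i = l then of_int (h x) else f (\<beta> (c x)) i)" for x i
  have "rank_witness N (insert l I) F"
    unfolding rank_witness_def
  proof (intro conjI ballI allI impI)
    show "finite (insert l I)" using finI by simp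
    show "additive_on N (\<lambda>x. F x i)" for i
      unfolding additive_on_def
    proof (intro ballI)
      fix x y assume xy: "x \<in> carrier N" "y \<in> carrier N"
      show "F (x \<otimes>\<^bsub>N\<^esub> y) i = F x i + F y i"
        using add[of i] xy \<beta>(1)[OF c] cadd \<beta>add[OF c c]
        unfolding F_def additive_on_def by (simp add: hadd)
    qed
    show "F x i = 0" if "x \<in> carrier N" "i \<notin> insert l I" for x i
      using rank_witnessD(3)[OF w(1)] that \<beta>(1)[OF c] unfolding F_def by auto
    show "\<exists>m::nat. m > 0 \<and> x [^]\<^bsub>N\<^esub> m = \<one>\<^bsub>N\<^esub>" if x: "x \<in> carrier N" and F0: "\<forall>i. F x i = 0" for x
    proof -
      have h0: "h x = 0" using F0 unfolding F_def by (metis of_int_eq_0_iff)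
      have "f (\<beta> (c x)) i = 0" for i
        using F0[rule_format, of i] rank_witnessD(3)[OF w(1) \<beta>(1)[OF c[OF x]] l] unfolding F_def
        by (cases "i = l") auto
      then obtain m :: nat where m: "m > 0" "\<beta> (c x) [^]\<^bsub>M\<^esub> m = \<one>\<^bsub>M\<^esub>"
        using rank_witnessD(4)[OF w(1) \<beta>(1)[OF c[OF x]]] by blast
      then have "c x [^]\<^bsub>N\<^esub> m = \<one>\<^bsub>N\<^esub>"
        using \<beta>[OF c[OF x]] \<alpha>.hom_nat_pow[of "\<beta> (c x)" m] by simp
      moreover have "c x = x [^]\<^bsub>N\<^esub> n" using h0 x by (simp add: c_def)
      ultimately have "x [^]\<^bsub>N\<^esub> (n * int m) = \<one>\<^bsub>N\<^esub>"
        using x by (metis N.int_pow_pow int_pow_int mult.commute)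
      then show ?thesis using N.torsion_int_pow[OF x] m s n_def by auto
    qed
    show "\<exists>b\<in>carrier N. F b j \<noteq> 0 \<and> (\<forall>i. i \<noteq> j \<longrightarrow> F b i = 0)" if j: "j \<in> insert l I" for j
    \<comment> \<open>As \<open>c s\<close> is trivial, \<open>s\<close> is a unit vector for
      \<open>l\<close>. For an old index, \<open>c\<close> raises the image of a unit vector of
      \<open>M\<close> to the power \<open>n\<close>, which only rescales its coordinates.\<close>
    proof (cases "j = l")
      case True
      have "c s = \<one>\<^bsub>N\<^esub>" using s unfolding c_def n_def by (simp add: N.int_pow_neg)
      then have "\<beta> (c s) = \<one>\<^bsub>M\<^esub>" using \<beta>\<alpha>[of "\<one>\<^bsub>M\<^esub>"] by simp
      then have "f (\<beta> (c s)) i = 0" for i using M.additive_on_one[OF add] by simp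
      then show ?thesis using True s by (intro bexI[of _ s]) (auto simp: F_def)
    next
      case False
      then obtain b where b: "b\<in>carrier M" "f b j \<noteq> 0" "\<forall>i. i \<noteq> j \<longrightarrow> f b i = 0"
        using rank_witnessD(5)[OF w(1)] j by blast
      have hb: "h (\<alpha> b) = 0" "\<alpha> b \<in> carrier N" using ker b by auto
      then have "c (\<alpha> b) = \<alpha> (b [^]\<^bsub>M\<^esub> n)" using b \<alpha>.hom_int_pow[of b n] by (simp add: c_def)
      then have "\<beta> (c (\<alpha> b)) = b [^]\<^bsub>M\<^esub> n" using \<beta>\<alpha> b by simp
      then have "f (\<beta> (c (\<alpha> b))) i = of_int n * f b i" for i
        using M.additive_on_int_pow[OF add b(1)] by simp
      then show ?thesis using b hb False s n_def by (intro bexI[of _ "\<alpha> b"]) (auto simp: F_def)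
    qed
  qed
  then show ?thesis using l finI w(2) unfolding has_rank_def by (metis card_insert_disjoint)
qed

text \<open>The sequence is \<open>0 \<rightarrow> M \<rightarrow> N \<rightarrow> Z \<rightarrow>
  M' \<rightarrow> N' \<rightarrow> 0\<close>, and the alternatives depend on the order of
  \<open>g\<close>, the image under \<open>\<gamma>\<close> of a generator of \<open>Z\<close>. If
  \<open>g\<close> has infinite order, \<open>\<gamma>\<close> is injective, so
  \<open>\<beta>\<close> is trivial and \<open>\<alpha>\<close> an isomorphism, and
  \<open>N'\<close> loses one rank. If \<open>g\<close> is torsion, the rank of \<open>M'\<close> is
  kept and a multiple of the generator lifts to \<open>N\<close>.\<close>

lemma has_rank_exact_integer:
  assumes G: "comm_group M" "comm_group N" "group Z" "comm_group M'" "group N'"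
    and hom: "\<alpha> \<in> hom M N" "\<beta> \<in> hom N Z" "\<gamma> \<in> hom Z M'" "\<delta> \<in> hom M' N'"
    and inj: "inj_on \<alpha> (carrier M)" and surj: "\<delta> ` carrier M' = carrier N'"
    and ex: "\<alpha> ` carrier M = kernel N Z \<beta>" "\<beta> ` carrier N = kernel Z M' \<gamma>" "\<gamma> ` carrier Z = kernel M' N' \<delta>"
    and Z: "Z \<cong> integer_group" and rk: "has_rank M a" "has_rank M' b"
  shows "(has_rank N a \<and> b > 0 \<and> has_rank N' (b - 1)) \<or> (has_rank N (Suc a) \<and> has_rank N' b)"
proof -
  interpret M: comm_group M by fact
  interpret N: comm_group N by fact
  interpret Z: group Z by fact
  interpret M': comm_group M' by fact
  interpret N': group N' by fact
  interpret \<alpha>: group_hom M N \<alpha> using hom by unfold_locales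
  interpret \<beta>: group_hom N Z \<beta> using hom by unfold_locales
  interpret \<gamma>: group_hom Z M' \<gamma> using hom by unfold_locales
  interpret \<delta>: group_hom M' N' \<delta> using hom by unfold_locales
  obtain \<phi> where \<phi>: "\<phi> \<in> iso integer_group Z"
    using Z Z.iso_sym by (auto simp: is_iso_def)
  interpret \<phi>: group_hom integer_group Z \<phi>
    using \<phi> by (simp add: group_hom_def group_hom_axioms_def iso_def)
  define z where "z = \<phi> 1"
  have z: "z \<in> carrier Z" by (simp add: z_def)
  have \<phi>z: "\<phi> k = z [^]\<^bsub>Z\<^esub> k" for k :: int
    using \<phi>.hom_int_pow[of 1 k] by (simp add: z_def)
  have bij: "bij_betw \<phi> UNIV (carrier Z)" using \<phi> by (simp add: iso_def)
  have car: "carrier Z = range (\<lambda>k::int. z [^]\<^bsub>Z\<^esub> k)"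
    using bij \<phi>z by (auto simp: bij_betw_def)
  have zinj: "inj (\<lambda>k::int. z [^]\<^bsub>Z\<^esub> k)"
    using bij \<phi>z by (auto simp: bij_betw_def inj_on_def)
  define g where "g = \<gamma> z"
  have g: "g \<in> carrier M'" using z by (simp add: g_def)
  have \<gamma>z: "\<gamma> (z [^]\<^bsub>Z\<^esub> k) = g [^]\<^bsub>M'\<^esub> k" for k :: int
    using z \<gamma>.hom_int_pow by (simp add: g_def)
  have ker\<delta>: "kernel M' N' \<delta> = range (\<lambda>k::int. g [^]\<^bsub>M'\<^esub> k)"
    unfolding ex(3)[symmetric] car image_image using \<gamma>z by simp
  have gh\<delta>: "group_hom M' N' \<delta>" ..
  show ?thesis
  proof (cases "\<exists>n::nat. n > 0 \<and> g [^]\<^bsub>M'\<^esub> n = \<one>\<^bsub>M'\<^esub>")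
    case False
    then have "b > 0 \<and> has_rank N' (b - 1)"
      by (intro has_rank_quotient_infinite[OF gh\<delta> M'.comm_group_axioms surj ker\<delta> g _ rk(2)]) blast
    moreover have "kernel N Z \<beta> = carrier N"
    proof -
      have "x = \<one>\<^bsub>Z\<^esub>" if x: "x \<in> carrier Z" "\<gamma> x = \<one>\<^bsub>M'\<^esub>" for x
      proof -
        obtain k :: int where k: "x = z [^]\<^bsub>Z\<^esub> k" using x car by auto
        then have "g [^]\<^bsub>M'\<^esub> k = \<one>\<^bsub>M'\<^esub>" using x \<gamma>z by simp
        then have "k = 0" using M'.torsion_int_pow[OF g] False by auto
        then show ?thesis using k by simp
      qed
      then have "kernel Z M' \<gamma> \<subseteq> {\<one>\<^bsub>Z\<^esub>}" by (auto simp: kernel_def)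
      then show ?thesis using ex(2) by (auto simp: kernel_def)
    qed
    then have "\<alpha> \<in> iso M N" using ex(1) inj hom(1) by (auto simp: iso_def bij_betw_def)
    then have "has_rank N a" using has_rank_iso[OF M.group_axioms N.group_axioms _ rk(1)] by (auto simp: is_iso_def)
    ultimately show ?thesis by blast
  next
    case True
    then obtain n :: nat where n: "n > 0" "g [^]\<^bsub>M'\<^esub> n = \<one>\<^bsub>M'\<^esub>" by blast
    have "has_rank N' b"
      using has_rank_quotient_torsion[OF gh\<delta> M'.comm_group_axioms surj ker\<delta> g n(2,1) rk(2)] .
    moreover have "has_rank N (Suc a)"
    proof -
      \<comment> \<open>The exponent of \<open>\<beta> x\<close> with respect to the generator
        \<open>z\<close>. Since \<open>g [^] n\<close> is trivial, \<open>z [^] n\<close> lies in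
        the image of \<open>\<beta>\<close>; a lift \<open>s\<close> has \<open>h s = n > 0\<close>,
        whether or not \<open>z\<close> itself lifts.\<close>
      define h where "h x = inv_into UNIV (\<lambda>k::int. z [^]\<^bsub>Z\<^esub> k) (\<beta> x)" for x
      have h: "z [^]\<^bsub>Z\<^esub> h x = \<beta> x" if "x \<in> carrier N" for x
        using that car unfolding h_def
        by (metis (no_types, lifting) \<beta>.hom_closed f_inv_into_f)
      have heq: "h x = k" if "x \<in> carrier N" "z [^]\<^bsub>Z\<^esub> k = \<beta> x" for x k
        using h[OF that(1)] that(2) zinj by (metis injD)
      have "z [^]\<^bsub>Z\<^esub> (int n) \<in> kernel Z M' \<gamma>"
        using n z \<gamma>z[of "int n"] by (simp add: kernel_def int_pow_int)
      then obtain s where s: "s \<in> carrier N" "\<beta> s = z [^]\<^bsub>Z\<^esub> (int n)"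
        using ex(2) by (metis (no_types, lifting) image_iff)
      show ?thesis
      proof (rule has_rank_extension[OF \<alpha>.group_hom_axioms M.comm_group_axioms N.comm_group_axioms inj _ _ s(1) _ rk(1), of h])
        show "h (x \<otimes>\<^bsub>N\<^esub> y) = h x + h y" if "x \<in> carrier N" "y \<in> carrier N" for x y
          by (rule heq) (use that h z in \<open>simp_all add: Z.int_pow_mult\<close>)
        show "\<alpha> ` carrier M = {x \<in> carrier N. h x = 0}"
          unfolding ex(1) kernel_def using h heq[where k = 0] by fastforce
        show "h s > 0" using heq[OF s(1)] s n by simp
      qed
    qed
    ultimately show ?thesis by blast
  qed
qed

section \<open>Attaching a cell\<close>

text \<open>Central projection from \<open>c\<close>: the ray from \<open>c\<close> through
  \<open>x\<close> leaves \<open>P\<close> at \<open>r x\<close>. The last property keeps the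
  straight homotopy from \<open>x\<close> to \<open>r x\<close> away from \<open>c\<close>.\<close>

lemma radial_retraction:
  fixes P :: "'a::euclidean_space set"
  assumes P: "compact P" "convex P" and c: "c \<in> rel_interior P"
  obtains r where "continuous_on (P - {c}) r" "r ` (P - {c}) \<subseteq> rel_frontier P"
    "\<And>x. x \<in> rel_frontier P \<Longrightarrow> r x = x"
    "\<And>x. x \<in> P - {c} \<Longrightarrow> c \<notin> closed_segment x (r x)"
proof -
  define S where "S = (+) (- c) ` rel_frontier P"
  define V where "V = (+) (- c) ` (affine hull P)"
  have cP: "c \<in> P" using c rel_interior_subset by blast
  then have caff: "c \<in> affine hull P" by (rule hull_inc)
  have bP: "bounded P" using P compact_imp_bounded by blast
  have subV: "subspace V"
    unfolding V_def using affine_diffs_subspace[OF affine_affine_hull caff] by simp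
  have "\<exists>d. 0 < d \<and> c + d *\<^sub>R x \<in> rel_frontier P \<and> (\<forall>e. 0 \<le> e \<and> e < d \<longrightarrow> c + e *\<^sub>R x \<in> rel_interior P)"
    if x: "x \<in> V - {0}" for x
  proof -
    have "c + x \<in> affine hull P" "x \<noteq> 0" using x by (auto simp: V_def)
    then obtain d where "0 < d" "c + d *\<^sub>R x \<in> rel_frontier P"
      "\<And>e. \<lbrakk>0 \<le> e; e < d\<rbrakk> \<Longrightarrow> c + e *\<^sub>R x \<in> rel_interior P"
      by (rule ray_to_rel_frontier[OF bP c]) blast
    then show ?thesis by (intro exI[of _ d]) simp
  qed
  then have "\<forall>x\<in>V - {0}. \<exists>d. 0 < d \<and> c + d *\<^sub>R x \<in> rel_frontier P \<and> (\<forall>e. 0 \<le> e \<and> e < d \<longrightarrow> c + e *\<^sub>R x \<in> rel_interior P)"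
    by blast
  from bchoice[OF this] obtain d where d: "\<And>x. x \<in> V - {0} \<Longrightarrow> 0 < d x \<and> c + d x *\<^sub>R x \<in> rel_frontier P"
    and d_int: "\<And>x e. x \<in> V - {0} \<Longrightarrow> 0 \<le> e \<Longrightarrow> e < d x \<Longrightarrow> c + e *\<^sub>R x \<in> rel_interior P"
    by blast
  \<comment> \<open>Of two frontier points on one ray from \<open>c\<close>, the nearer would lie on
    an open segment from \<open>c\<close> to a point of the closure, hence in the relative
    interior.\<close>
  have uniq: "k = d x" if x: "x \<in> V - {0}" and k: "0 < k" "c + k *\<^sub>R x \<in> rel_frontier P" for x k
  proof (rule ccontr)
    assume "k \<noteq> d x"
    then consider "k < d x" | "d x < k" by linarith
    then show False
    proof cases
      case 1
      then show False using d_int[OF x, of k] k by (simp add: rel_frontier_def)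
    next
      case 2
      have "c + k *\<^sub>R x \<in> closure P" using k by (simp add: rel_frontier_def)
      then have "open_segment c (c + k *\<^sub>R x) \<subseteq> rel_interior P"
        by (rule rel_interior_closure_convex_segment[OF P(2) c])
      moreover have "c + d x *\<^sub>R x \<in> open_segment c (c + k *\<^sub>R x)"
        unfolding in_segment
        using 2 d[OF x] x k by (auto simp: algebra_simps intro!: exI[of _ "d x / k"])
      ultimately show False using d[OF x] by (auto simp: rel_frontier_def)
    qed
  qed
  have S: "y \<in> S \<longleftrightarrow> c + y \<in> rel_frontier P" for y
    by (auto simp: S_def image_iff intro!: bexI[of _ "c + y"])
  \<comment> \<open>Continuity of the scaling is a consequence of uniqueness: each ray of
    \<open>V\<close> meets the compact set \<open>S\<close> in exactly one positive
    multiple.\<close>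
  have "continuous_on (V - {0}) (\<lambda>x. d x *\<^sub>R x)"
  proof (rule continuous_on_compact_surface_projection)
    show "compact S"
      unfolding S_def by (intro compact_translation compact_rel_frontier_bounded bP)
    have "c \<notin> rel_frontier P" using c by (simp add: rel_frontier_def)
    moreover have "rel_frontier P \<subseteq> affine hull P" by (rule rel_frontier_affine_hull)
    ultimately show "S \<subseteq> V - {0}" unfolding S_def V_def by force
    show "Convex.cone V" using subV by (rule subspace_imp_cone)
    show "0 < k \<and> k *\<^sub>R x \<in> S \<longleftrightarrow> d x = k" if "x \<in> V - {0}" for x k
      using d[OF that] uniq[OF that, of k] by (auto simp: S)
  qed
  then have cont: "continuous_on (V - {0}) (\<lambda>x. c + d x *\<^sub>R x)" by (intro continuous_on_add continuous_on_const)
  define r where "r x = c + d (x - c) *\<^sub>R (x - c)" for x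
  have PV: "x - c \<in> V - {0}" if "x \<in> P - {c}" for x
  proof -
    have "x \<in> affine hull P" using that by (simp add: hull_inc)
    then show ?thesis using that unfolding V_def by force
  qed
  show ?thesis
  proof
    show "continuous_on (P - {c}) r"
    proof -
      have "continuous_on (P - {c}) ((\<lambda>x. c + d x *\<^sub>R x) \<circ> (\<lambda>x. x - c))"
        by (intro continuous_on_compose continuous_intros continuous_on_subset[OF cont]) (use PV in auto)
      then show ?thesis by (simp add: r_def[abs_def] o_def)
    qed
    show "r ` (P - {c}) \<subseteq> rel_frontier P"
      unfolding r_def using d[OF PV] by blast
    show "r x = x" if x: "x \<in> rel_frontier P" for x
    proof -
      have "x \<in> P - {c}" using x c P(1) by (auto simp: rel_frontier_def compact_imp_closed)
      from uniq[OF PV[OF this], of 1] x show ?thesis by (simp add: r_def)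
    qed
    \<comment> \<open>Both \<open>x\<close> and \<open>r x\<close> are positive multiples of
      \<open>x - c\<close> as seen from \<open>c\<close>, so no convex combination of them is
      \<open>c\<close>.\<close>
    show "c \<notin> closed_segment x (r x)" if x: "x \<in> P - {c}" for x
    proof
      assume "c \<in> closed_segment x (r x)"
      then obtain u where u: "0 \<le> u" "u \<le> 1" "c = (1 - u) *\<^sub>R x + u *\<^sub>R r x" by (auto simp: in_segment)
      then have "((1 - u) + u * d (x - c)) *\<^sub>R (x - c) = 0"
        by (simp add: r_def algebra_simps)
      moreover have "(1 - u) + u * d (x - c) > 0"
        using d[OF PV[OF x]] u by (cases "u = 0") (auto simp: add_nonneg_pos)
      ultimately show False using x by auto
    qed
  qed
qed

text \<open>As \<open>P\<close> is contractible, the relative group in degree \<open>p\<close> is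
  the reduced homology of \<open>P - {c}\<close> in degree \<open>p - 1\<close>, and
  \<open>P - {c}\<close> is homotopy equivalent to a sphere of dimension
  \<open>n - 1\<close>.\<close>

lemma relative_homology_convex_point:
  fixes P :: "'a::euclidean_space set"
  assumes P: "compact P" "convex P" and c: "c \<in> rel_interior P" and n: "aff_dim P = int n"
  shows "p = int n \<Longrightarrow> relative_homology_group p (top_of_set P) (P - {c}) \<cong> integer_group"
    and "p \<noteq> int n \<Longrightarrow> trivial_group (relative_homology_group p (top_of_set P) (P - {c}))"
proof -
  have cP: "c \<in> P" using c rel_interior_subset by blast
  have bP: "bounded P" using P compact_imp_bounded by blast
  have "(p = int n \<longrightarrow> relative_homology_group p (top_of_set P) (P - {c}) \<cong> integer_group) \<and>
    (p \<noteq> int n \<longrightarrow> trivial_group (relative_homology_group p (top_of_set P) (P - {c})))"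
  proof (cases n)
    \<comment> \<open>Here \<open>P - {c}\<close> is empty, which no \<open>nsphere\<close> models;
      the relative group is the homology of a point.\<close>
    case 0
    then have "P = {c}" using n cP aff_dim_eq_0[of P] by auto
    then show ?thesis
      using homology_coefficients[of "top_of_set {c}" c] homology_dimension_axiom[of "top_of_set {c}" c p] 0
      by auto
  next
    case (Suc m)
    have "P \<noteq> {}" using cP by blast
    have le: "aff_dim P \<le> int (dim (UNIV :: 'a set))" using aff_dim_le_DIM[of P] by simp
    obtain T :: "'a set" where T: "subspace T" "aff_dim T = aff_dim P" "rel_frontier P homeomorphic sphere 0 1 \<inter> T"
      by (rule spheremap_lemma3[OF bP P(2) subspace_UNIV le]) (use \<open>P \<noteq> {}\<close> in blast)
    \<comment> \<open>The sphere just obtained lies in a subspace \<open>T\<close> of the ambient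
      space; an orthonormal basis of \<open>T\<close> identifies it with
      \<open>nsphere m\<close>.\<close>
    obtain B where B: "B \<subseteq> T" "pairwise orthogonal B" "\<And>x. x \<in> B \<Longrightarrow> norm x = 1"
      "independent B" "card B = dim T" "span B = T"
      using orthonormal_basis_subspace[OF T(1)] by blast
    have dimT: "dim T = n" using T n by (simp add: aff_dim_subspace)
    obtain f :: "(nat \<Rightarrow> real) \<Rightarrow> 'a" and g where "homeomorphic_maps (nsphere (n - 1)) (top_of_set (sphere 0 1 \<inter> span B)) f g"
      using homeomorphic_maps_nsphere_euclidean_sphere[OF B(4) B(2) B(5)] B(3) dimT Suc by auto
    then have "nsphere m homeomorphic_space top_of_set (sphere 0 1 \<inter> T)"
      using B(6) Suc by (auto simp: homeomorphic_space_def)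
    moreover have "top_of_set (sphere 0 1 \<inter> T) homeomorphic_space top_of_set (rel_frontier P)"
      using T(3) homeomorphic_sym by auto
    ultimately have "nsphere m homeomorphic_space top_of_set (rel_frontier P)"
      using homeomorphic_space_trans by blast
    moreover have "rel_frontier P homotopy_eqv (P - {c})"
      using P bP c
      by (intro homotopy_eqv_rel_frontier_punctured_convex)
         (auto simp: rel_frontier_def compact_imp_closed hull_subset)
    ultimately have "nsphere m homotopy_equivalent_space top_of_set (P - {c})"
      by (meson homeomorphic_imp_homotopy_equivalent_space homotopy_eqv_trans)
    then have 1: "reduced_homology_group (p - 1) (nsphere m) \<cong> reduced_homology_group (p - 1) (top_of_set (P - {c}))"
      by (rule homotopy_equivalent_space_imp_isomorphic_reduced_homology_groups)
    have "P - {c} \<noteq> {}"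
    proof
      assume "P - {c} = {}"
      then have "P = {c}" using cP by auto
      then show False using n Suc by simp
    qed
    then have "relative_homology_group p (top_of_set P) (P - {c})
        \<cong> reduced_homology_group (p - 1) (subtopology (top_of_set P) (P - {c}))"
      using P(2) by (intro isomorphic_group_relative_homology_of_contractible) (auto intro: convex_imp_contractible)
    moreover have "subtopology (top_of_set P) (P - {c}) = top_of_set (P - {c})"
      by (simp add: subtopology_subtopology Int_absorb1)
    ultimately have "relative_homology_group p (top_of_set P) (P - {c}) \<cong> reduced_homology_group (p - 1) (top_of_set (P - {c}))"
      by simp
    also have "\<dots> \<cong> reduced_homology_group (p - 1) (nsphere m)"
      using 1 group.iso_sym group_reduced_homology_group by blast
    finally have iso: "relative_homology_group p (top_of_set P) (P - {c}) \<cong> reduced_homology_group (p - 1) (nsphere m)" .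
    show ?thesis
    proof (intro conjI impI)
      assume "p = int n"
      then have "reduced_homology_group (p - 1) (nsphere m) \<cong> integer_group"
        using reduced_homology_group_nsphere(1)[of m] Suc by simp
      then show "relative_homology_group p (top_of_set P) (P - {c}) \<cong> integer_group"
        using iso iso_trans by blast
    next
      assume "p \<noteq> int n"
      then have "trivial_group (reduced_homology_group (p - 1) (nsphere m))"
        using reduced_homology_group_nsphere(2)[of "p - 1" m] Suc by simp
      then show "trivial_group (relative_homology_group p (top_of_set P) (P - {c}))"
        using isomorphic_group_triviality[OF iso] by simp
    qed
  qed
  then show "p = int n \<Longrightarrow> relative_homology_group p (top_of_set P) (P - {c}) \<cong> integer_group"
    and "p \<noteq> int n \<Longrightarrow> trivial_group (relative_homology_group p (top_of_set P) (P - {c}))" by auto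
qed

text \<open>The identity of \<open>A\<close> and the radial retraction of \<open>P - {c}\<close>
  agree on \<open>rel_frontier P\<close> and are defined on relatively closed pieces, so they
  combine to a retraction onto \<open>A\<close>, homotopic to the identity along segments.\<close>

lemma homology_attach_cell:
  fixes A P :: "'a::euclidean_space set"
  assumes A: "closed A" and P: "compact P" "convex P" and AP: "A \<inter> P = rel_frontier P"
    and c: "c \<in> rel_interior P"
  shows "homology_group p (top_of_set (A \<union> P - {c})) \<cong> homology_group p (top_of_set A)"
    and "relative_homology_group p (top_of_set (A \<union> P)) (A \<union> P - {c})
       \<cong> relative_homology_group p (top_of_set P) (P - {c})"
proof -
  have cP: "c \<in> P" using c rel_interior_subset by blast
  have cA: "c \<notin> A" using c cP AP by (auto simp: rel_frontier_def)
  have closedP: "closed P" using P compact_imp_closed by blast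
  obtain r where r: "continuous_on (P - {c}) r" "r ` (P - {c}) \<subseteq> rel_frontier P"
    "\<And>x. x \<in> rel_frontier P \<Longrightarrow> r x = x" "\<And>x. x \<in> P - {c} \<Longrightarrow> c \<notin> closed_segment x (r x)"
    using radial_retraction[OF P c] by blast
  define \<rho> where "\<rho> x = (if x \<in> A then x else r x)" for x
  have XP: "A \<union> P - {c} = A \<union> (P - {c})" using cA by auto
  have cont: "continuous_on (A \<union> P - {c}) \<rho>"
    unfolding XP \<rho>_def[abs_def]
  proof (rule continuous_on_cases_local)
    show "closedin (top_of_set (A \<union> (P - {c}))) A"
      using A by (intro closed_subset) auto
    have "P - {c} = (A \<union> (P - {c})) \<inter> P" using cA AP by auto
    then show "closedin (top_of_set (A \<union> (P - {c}))) (P - {c})"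
      using closedP by (metis closedin_closed_Int)
    show "x = r x" if "x \<in> A \<and> x \<notin> A \<or> x \<in> P - {c} \<and> x \<in> A" for x
      using r(3)[of x, symmetric] AP that by blast
  qed (use r in \<open>auto intro: continuous_intros\<close>)
  have \<rho>A: "\<rho> x \<in> A" if "x \<in> A \<union> P - {c}" for x
    using that r(2) AP by (auto simp: \<rho>_def)
  \<comment> \<open>The segment lies in the convex set \<open>P\<close> and misses \<open>c\<close>
    by the choice of \<open>r\<close>.\<close>
  have seg: "closed_segment (\<rho> x) x \<subseteq> A \<union> P - {c}" if x: "x \<in> A \<union> P - {c}" for x
  proof (cases "x \<in> A")
    case True
    then show ?thesis using cA by (auto simp: \<rho>_def)
  next
    case False
    then have xP: "x \<in> P - {c}" using x by auto
    then have "r x \<in> P" using r(2) AP by auto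
    then have "closed_segment x (r x) \<subseteq> P" using xP P(2) by (simp add: closed_segment_subset)
    then show ?thesis using r(4)[OF xP] False by (auto simp: \<rho>_def closed_segment_commute)
  qed
  have hom: "homotopic_with_canon (\<lambda>_. True) (A \<union> P - {c}) (A \<union> P - {c}) \<rho> id"
    by (rule homotopic_with_linear[OF cont]) (use seg in \<open>auto intro: continuous_intros\<close>)
  have "retraction_maps (top_of_set (A \<union> P - {c})) (top_of_set A) \<rho> id"
    unfolding retraction_maps_def
    using cont \<rho>A cA by (auto simp: \<rho>_def)
  then show "homology_group p (top_of_set (A \<union> P - {c})) \<cong> homology_group p (top_of_set A)"
    by (rule deformation_retraction_imp_isomorphic_homology_groups) (use hom in simp)
  let ?E = "top_of_set (A \<union> P)"
  have "hom_induced p (subtopology ?E ((A \<union> P) - (A \<union> P - P))) ((A \<union> P - {c}) - (A \<union> P - P)) (subtopology ?E (A \<union> P)) (A \<union> P - {c}) id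
    \<in> iso (relative_homology_group p (subtopology ?E ((A \<union> P) - (A \<union> P - P))) ((A \<union> P - {c}) - (A \<union> P - P)))
          (relative_homology_group p (subtopology ?E (A \<union> P)) (A \<union> P - {c}))"
  proof (rule homology_excision_axiom)
    \<comment> \<open>The excised set is \<open>A - P\<close>. Its closure stays in the closed set
      \<open>A\<close>, which misses \<open>c\<close>, whereas \<open>A \<union> P - {c}\<close> is
      open in the union.\<close>
    have "?E closure_of (A \<union> P - P) \<subseteq> A"
      using A by (intro closure_of_minimal closed_subset) auto
    moreover have "openin ?E (A \<union> P - {c})"
      by (simp add: openin_delete)
    then have "?E interior_of (A \<union> P - {c}) = A \<union> P - {c}" by (simp add: interior_of_openin)
    ultimately show "?E closure_of (A \<union> P - P) \<subseteq> ?E interior_of (A \<union> P - {c})" using cA by auto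
  qed auto
  moreover have "(A \<union> P) - (A \<union> P - P) = P" "(A \<union> P - {c}) - (A \<union> P - P) = P - {c}" by auto
  moreover have "subtopology ?E P = top_of_set P" "subtopology ?E (A \<union> P) = ?E"
    by (simp_all add: subtopology_subtopology Int_absorb1)
  ultimately have "relative_homology_group p (top_of_set P) (P - {c}) \<cong> relative_homology_group p ?E (A \<union> P - {c})"
    by (auto simp: is_iso_def)
  then show "relative_homology_group p ?E (A \<union> P - {c}) \<cong> relative_homology_group p (top_of_set P) (P - {c})"
    by (simp add: group.iso_sym)
qed

lemma trivial_groupD: "trivial_group G \<Longrightarrow> carrier G = {\<one>\<^bsub>G\<^esub>}"
  by (simp add: trivial_group_def)

text \<open>Relative homology is concentrated in degree \<open>n\<close>, so the long exact sequence
  breaks into isomorphisms away from the degrees \<open>n\<close> and \<open>n - 1\<close> and one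
  sequence of the shape of \<open>has_rank_exact_integer\<close>.\<close>

lemma has_rank_attach_cell:
  fixes A P :: "'a::euclidean_space set"
  assumes A: "closed A" and P: "compact P" "convex P" "aff_dim P = int n" and AP: "A \<inter> P = rel_frontier P"
    and rk: "\<And>p. has_rank (homology_group p (top_of_set A)) (r p)"
  obtains r' where "\<And>p. has_rank (homology_group p (top_of_set (A \<union> P))) (r' p)"
    "\<And>p. p \<noteq> int n \<Longrightarrow> p \<noteq> int n - 1 \<Longrightarrow> r' p = r p"
    "int (r' (int n)) - int (r' (int n - 1)) = int (r (int n)) - int (r (int n - 1)) + 1"
proof -
  have "P \<noteq> {}" using P(3) by auto
  then obtain c where c: "c \<in> rel_interior P" using P(2) rel_interior_eq_empty by blast
  define E where "E = top_of_set (A \<union> P)"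
  define S where "S = A \<union> P - {c}"
  have ES: "subtopology E S = top_of_set S"
    by (simp add: E_def S_def subtopology_subtopology Int_absorb1)
  have rkS: "has_rank (homology_group p (subtopology E S)) (r p)" for p
    unfolding ES unfolding S_def
    by (rule has_rank_iso[OF _ _ _ rk[of p]])
       (simp_all add: group.iso_sym homology_attach_cell(1)[OF A P(1,2) AP c, of p])
  have rel_iso: "relative_homology_group p E S \<cong> relative_homology_group p (top_of_set P) (P - {c})" for p
    unfolding E_def S_def by (rule homology_attach_cell(2)[OF A P(1,2) AP c])
  have rel: "relative_homology_group (int n) E S \<cong> integer_group"
    "p \<noteq> int n \<Longrightarrow> trivial_group (relative_homology_group p E S)" for p
    by (rule iso_trans[OF rel_iso relative_homology_convex_point(1)[OF P(1,2) c P(3) refl]])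
       (simp add: isomorphic_group_triviality[OF rel_iso[of p]] relative_homology_convex_point(2)[OF P(1,2) c P(3), of p])
  define \<alpha> where "\<alpha> p = hom_induced p (subtopology E S) {} E {} id" for p
  define \<beta> where "\<beta> p = hom_induced p E {} E S id" for p
  define \<gamma> where "\<gamma> p = hom_boundary p E S" for p
  have hom: "\<alpha> p \<in> hom (homology_group p (subtopology E S)) (homology_group p E)"
    "\<beta> p \<in> hom (homology_group p E) (relative_homology_group p E S)"
    "\<gamma> p \<in> hom (relative_homology_group p E S) (homology_group (p - 1) (subtopology E S))" for p
    unfolding \<alpha>_def \<beta>_def \<gamma>_def by (auto simp: hom_induced_hom hom_boundary_hom)
  have ex1: "\<beta> p ` carrier (homology_group p E) =
      kernel (relative_homology_group p E S) (homology_group (p - 1) (subtopology E S)) (\<gamma> p)" for p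
    using homology_exactness_axiom_1[of p E S] by (simp add: \<beta>_def \<gamma>_def)
  have ex2: "\<gamma> p ` carrier (relative_homology_group p E S) =
      kernel (homology_group (p - 1) (subtopology E S)) (homology_group (p - 1) E) (\<alpha> (p - 1))" for p
    using homology_exactness_axiom_2[of p E S] by (simp add: \<alpha>_def \<gamma>_def)
  have ex3: "\<alpha> p ` carrier (homology_group p (subtopology E S)) =
      kernel (homology_group p E) (relative_homology_group p E S) (\<beta> p)" for p
    using homology_exactness_axiom_3[of p E S] by (simp add: \<alpha>_def \<beta>_def)
  \<comment> \<open>The kernel of \<open>\<alpha> p\<close> is the image of the relative group in
    degree \<open>p + 1\<close>, which is trivial unless that degree is \<open>n\<close>.\<close>
  have inj: "inj_on (\<alpha> p) (carrier (homology_group p (subtopology E S)))" if "p + 1 \<noteq> int n" for p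
  proof -
    interpret group_hom "homology_group p (subtopology E S)" "homology_group p E" "\<alpha> p"
      using hom(1) by (simp add: group_hom_def group_hom_axioms_def)
    interpret g: group_hom "relative_homology_group (p+1) E S" "homology_group p (subtopology E S)" "\<gamma> (p+1)"
      using hom(3)[of "p+1"] by (simp add: group_hom_def group_hom_axioms_def)
    have "kernel (homology_group p (subtopology E S)) (homology_group p E) (\<alpha> p)
        = \<gamma> (p+1) ` {\<one>\<^bsub>relative_homology_group (p+1) E S\<^esub>}"
      using ex2[of "p+1"] trivial_groupD[OF rel(2)[OF that]] by simp
    then show ?thesis using g.hom_one by (intro trivial_ker_imp_inj) auto
  qed
  have surj: "\<alpha> p ` carrier (homology_group p (subtopology E S)) = carrier (homology_group p E)" if "p \<noteq> int n" for p
    unfolding ex3 using trivial_groupD[OF rel(2)[OF that]] hom(2)[of p]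
    by (auto simp: kernel_def hom_def)
  have other: "has_rank (homology_group p E) (r p)" if "p \<noteq> int n" "p \<noteq> int n - 1" for p
  proof -
    have "\<alpha> p \<in> iso (homology_group p (subtopology E S)) (homology_group p E)"
      using inj[of p] surj[of p] hom(1) that by (auto simp: iso_def bij_betw_def)
    then show ?thesis using rkS[of p] has_rank_iso[of "homology_group p (subtopology E S)" "homology_group p E"]
      by (auto simp: is_iso_def)
  qed
  have "(has_rank (homology_group (int n) E) (r (int n)) \<and> r (int n - 1) > 0 \<and> has_rank (homology_group (int n - 1) E) (r (int n - 1) - 1)) \<or>
    (has_rank (homology_group (int n) E) (Suc (r (int n))) \<and> has_rank (homology_group (int n - 1) E) (r (int n - 1)))"
    by (rule has_rank_exact_integer[where \<alpha> = "\<alpha> (int n)" and \<beta> = "\<beta> (int n)" and \<gamma> = "\<gamma> (int n)" and \<delta> = "\<alpha> (int n - 1)"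
          and Z = "relative_homology_group (int n) E S" and M = "homology_group (int n) (subtopology E S)"
          and M' = "homology_group (int n - 1) (subtopology E S)"])
       (use hom ex1 ex2 ex3 inj surj rel(1) rkS in \<open>auto simp: abelian_homology_group\<close>)
  \<comment> \<open>In the first alternative the positivity of \<open>r (int n - 1)\<close> makes
    the natural-number subtraction a true one.\<close>
  then obtain a b where ab: "has_rank (homology_group (int n) E) a" "has_rank (homology_group (int n - 1) E) b"
    "int a - int b = int (r (int n)) - int (r (int n - 1)) + 1"
    by (auto simp: of_nat_diff)
  show ?thesis
    by (rule that[of "r(int n := a, int n - 1 := b)"]) (use ab other in \<open>auto simp: E_def\<close>)
qed

section \<open>Euler characteristic of polytopal spheres\<close>

lemma polytopal_complexD:
  assumes "polytopal_complex K"
  shows "finite K" "P \<in> K \<Longrightarrow> polytope P" "P \<in> K \<Longrightarrow> F face_of P \<Longrightarrow> F \<in> K"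
    "P \<in> K \<Longrightarrow> Q \<in> K \<Longrightarrow> P \<inter> Q face_of P" "P \<in> K \<Longrightarrow> Q \<in> K \<Longrightarrow> P \<inter> Q face_of Q"
  using assms unfolding polytopal_complex_def by blast+

lemma aff_dim_nonneg:
  fixes S :: "'a::euclidean_space set"
  shows "S \<noteq> {} \<Longrightarrow> 0 \<le> aff_dim S"
  using aff_dim_negative_iff[of S] by linarith

text \<open>Rewrites a sum graded by dimension as one over cells, where cells can be sorted by the
  complexes they belong to. The empty cell has to be taken out: its dimension \<open>-1\<close>
  becomes \<open>0\<close> under \<open>nat\<close>, so it would pass for a vertex.\<close>

lemma alternating_sum_faces_of_dim:
  fixes K :: "'a::euclidean_space set set" and g :: "'a set \<Rightarrow> 'b::comm_ring_1"
  assumes "finite K" "\<And>F. F \<in> K \<Longrightarrow> aff_dim F < int d"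
  shows "(\<Sum>i<d. (-1) ^ i * (\<Sum>F\<in>faces_of_dim i K. g F)) = (\<Sum>F\<in>K - {{}}. (-1) ^ nat (aff_dim F) * g F)"
proof -
  have "F \<noteq> {} \<and> nat (aff_dim F) = i \<longleftrightarrow> aff_dim F = int i" for F :: "'a set" and i
    using aff_dim_nonneg[of F] by (cases "F = {}") auto
  then have "{F \<in> K - {{}}. nat (aff_dim F) = i} = faces_of_dim i K" for i
    by (auto simp: faces_of_dim_def)
  then have "(\<Sum>i<d. (-1) ^ i * (\<Sum>F\<in>faces_of_dim i K. g F))
      = (\<Sum>i<d. \<Sum>F\<in>{F \<in> K - {{}}. nat (aff_dim F) = i}. (-1) ^ nat (aff_dim F) * g F)"
    by (simp add: sum_distrib_left faces_of_dim_def)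
  also have "\<dots> = (\<Sum>F\<in>K - {{}}. (-1) ^ nat (aff_dim F) * g F)"
  proof (rule sum.group)
    show "(\<lambda>F. nat (aff_dim F)) ` (K - {{}}) \<subseteq> {..<d}"
    proof
      fix i assume "i \<in> (\<lambda>F. nat (aff_dim F)) ` (K - {{}})"
      then obtain F where "F \<in> K" "F \<noteq> {}" "i = nat (aff_dim F)" by blast
      then show "i \<in> {..<d}" using assms(2)[of F] aff_dim_nonneg[of F] by auto
    qed
  qed (use assms in auto)
  finally show ?thesis .
qed

lemma euler_char_eq_sum:
  fixes K :: "'a::euclidean_space set set"
  assumes "finite K" "\<And>F. F \<in> K \<Longrightarrow> aff_dim F < int DIM('a)"
  shows "euler_char K = (\<Sum>F\<in>K - {{}}. (-1) ^ nat (aff_dim F))"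
  using alternating_sum_faces_of_dim[OF assms, of "\<lambda>_. 1 :: int"]
  by (simp add: euler_char_def)

text \<open>A cell of maximal dimension is not a face of another cell, so the rest is closed under
  faces and meets \<open>P\<close> only in proper faces; conversely the proper faces of
  \<open>P\<close> remain and cover its relative frontier.\<close>

lemma polytopal_complex_remove_maximal:
  assumes K: "polytopal_complex K" and P: "P \<in> K" and max: "\<And>Q. Q \<in> K \<Longrightarrow> aff_dim Q \<le> aff_dim P"
  shows "polytopal_complex (K - {P})" "\<Union>(K - {P}) \<inter> P = rel_frontier P"
proof -
  have notface: "\<not> P face_of Q" if "Q \<in> K - {P}" for Q
  proof
    assume "P face_of Q"
    then have "aff_dim P < aff_dim Q"
      using that polytopal_complexD(2)[OF K] by (intro face_of_aff_dim_lt) (auto simp: polytope_imp_convex)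
    then show False using max[of Q] that by auto
  qed
  show "polytopal_complex (K - {P})"
    using K notface unfolding polytopal_complex_def by blast
  have polyP: "polyhedron P" using polytopal_complexD(2)[OF K P] by (rule polytope_imp_polyhedron)
  show "\<Union>(K - {P}) \<inter> P = rel_frontier P"
  proof
    show "\<Union>(K - {P}) \<inter> P \<subseteq> rel_frontier P"
    proof
      fix x assume "x \<in> \<Union>(K - {P}) \<inter> P"
      then obtain Q where Q: "Q \<in> K - {P}" "x \<in> P \<inter> Q" by blast
      have "P \<inter> Q face_of P" "P \<inter> Q face_of Q" using polytopal_complexD(4,5)[OF K P, of Q] Q by auto
      moreover have "P \<inter> Q \<noteq> P" using \<open>P \<inter> Q face_of Q\<close> notface[OF Q(1)] by auto
      ultimately show "x \<in> rel_frontier P" using face_of_subset_rel_frontier Q(2) by blast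
    qed
    show "rel_frontier P \<subseteq> \<Union>(K - {P}) \<inter> P"
      unfolding rel_frontier_of_polyhedron_alt[OF polyP]
      using polytopal_complexD(3)[OF K P] face_of_imp_subset by blast
  qed
qed

text \<open>The index is shifted by one so that the attached vertices, whose boundary lives in degree
  \<open>-1\<close>, need no separate treatment.\<close>

theorem euler_poincare:
  fixes K :: "'a::euclidean_space set set"
  assumes "polytopal_complex K"
  shows "\<exists>r. (\<forall>p. has_rank (homology_group p (top_of_set (\<Union>K))) (r p)) \<and>
    (\<Sum>k\<le>Suc DIM('a). (-1) ^ k * int (r (int k - 1))) = - (\<Sum>F\<in>K - {{}}. (-1) ^ nat (aff_dim F))"
  using assms
proof (induction "card K" arbitrary: K)
  case 0
  then have "K = {}" using polytopal_complexD(1) by (metis card_0_eq)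
  then show ?case
    by (intro exI[of _ "\<lambda>_. 0"]) (auto intro!: has_rank_trivial trivial_homology_group_empty)
next
  case (Suc m)
  show ?case
  proof (cases "K \<subseteq> {{}}")
    case True
    then have "\<Union>K = {}" and e: "K - {{}} = {}" by auto
    then show ?thesis unfolding e
      by (intro exI[of _ "\<lambda>_. 0"]) (auto intro!: has_rank_trivial trivial_homology_group_empty)
  next
    case False
    note K = \<open>polytopal_complex K\<close>
    have finK: "finite K" by (rule polytopal_complexD(1)[OF K])
    have "Max (aff_dim ` K) \<in> aff_dim ` K" using finK False by (intro Max_in) auto
    then obtain P where P: "P \<in> K" "aff_dim P = Max (aff_dim ` K)" by auto
    have max: "aff_dim Q \<le> aff_dim P" if "Q \<in> K" for Q using P finK that by simp
    obtain Q where "Q \<in> K" "Q \<noteq> {}" using False by auto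
    then have "0 \<le> aff_dim P" using max[of Q] aff_dim_nonneg[of Q] by linarith
    then obtain n where n: "aff_dim P = int n" using nonneg_int_cases by blast
    have nd: "n \<le> DIM('a)" using aff_dim_le_DIM[of P] n by simp
    have Pne: "P \<noteq> {}" using n by auto
    note K' = polytopal_complex_remove_maximal[OF K P(1) max]
    have "m = card (K - {P})" using Suc(2) P(1) finK by simp
    from Suc(1)[OF this K'(1)] obtain r where
      r: "\<And>p. has_rank (homology_group p (top_of_set (\<Union>(K - {P})))) (r p)"
      and rsum: "(\<Sum>k\<le>Suc DIM('a). (-1) ^ k * int (r (int k - 1))) = - (\<Sum>F\<in>K - {P} - {{}}. (-1) ^ nat (aff_dim F))"
      by blast
    have polyP: "polytope P" using polytopal_complexD(2)[OF K P(1)] .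
    have "closed (\<Union>(K - {P}))"
      using finK polytopal_complexD(2)[OF K] by (intro closed_Union) (auto simp: polytope_imp_closed)
    then obtain r' where r': "\<And>p. has_rank (homology_group p (top_of_set (\<Union>(K - {P}) \<union> P))) (r' p)"
      "\<And>p. p \<noteq> int n \<Longrightarrow> p \<noteq> int n - 1 \<Longrightarrow> r' p = r p"
      "int (r' (int n)) - int (r' (int n - 1)) = int (r (int n)) - int (r (int n - 1)) + 1"
      using has_rank_attach_cell[OF _ polytope_imp_compact[OF polyP] polytope_imp_convex[OF polyP] n K'(2) r] by metis
    have "\<Union>(K - {P}) \<union> P = \<Union>K" using P(1) by auto
    moreover have "(\<Sum>k\<le>Suc DIM('a). (-1) ^ k * int (r' (int k - 1))) = - (\<Sum>F\<in>K - {{}}. (-1) ^ nat (aff_dim F))"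
    proof -
      have "(\<Sum>k\<le>Suc DIM('a). (-1) ^ k * int (r' (int k - 1))) - (\<Sum>k\<le>Suc DIM('a). (-1) ^ k * int (r (int k - 1)))
        = (\<Sum>k\<le>Suc DIM('a). (-1) ^ k * (int (r' (int k - 1)) - int (r (int k - 1))))"
        by (simp only: sum_subtractf right_diff_distrib)
      \<comment> \<open>By the shift, \<open>k = n\<close> and \<open>k = Suc n\<close> stand for
        the degrees \<open>n - 1\<close> and \<open>n\<close>, the only ones that change. The shift
        also reverses all signs, whence the minus on the right-hand side.\<close>
      also have "\<dots> = (\<Sum>k\<in>{n, Suc n}. (-1) ^ k * (int (r' (int k - 1)) - int (r (int k - 1))))"
      proof (rule sum.mono_neutral_right)
        show "{n, Suc n} \<subseteq> {..Suc DIM('a)}" using nd by auto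
        show "\<forall>k\<in>{..Suc DIM('a)} - {n, Suc n}. (-1) ^ k * (int (r' (int k - 1)) - int (r (int k - 1))) = 0"
        proof
          fix k assume "k \<in> {..Suc DIM('a)} - {n, Suc n}"
          then have "r' (int k - 1) = r (int k - 1)" by (intro r'(2)) auto
          then show "(-1) ^ k * (int (r' (int k - 1)) - int (r (int k - 1))) = 0" by simp
        qed
      qed simp
      also have "\<dots> = (-1) ^ n * ((int (r' (int n - 1)) - int (r (int n - 1))) - (int (r' (int n)) - int (r (int n))))"
        by (simp add: algebra_simps)
      also have "\<dots> = - ((-1) ^ n)"
      proof -
        have "(int (r' (int n - 1)) - int (r (int n - 1))) - (int (r' (int n)) - int (r (int n))) = -1"
          using r'(3) by linarith
        then show ?thesis by simp
      qed
      finally have *: "(\<Sum>k\<le>Suc DIM('a). (-1) ^ k * int (r' (int k - 1)))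
        = (\<Sum>k\<le>Suc DIM('a). (-1) ^ k * int (r (int k - 1))) - (-1) ^ n" by linarith
      have "(\<Sum>F\<in>K - {{}}. (-1) ^ nat (aff_dim F)) = (-1) ^ n + (\<Sum>F\<in>K - {{}} - {P}. (-1) ^ nat (aff_dim F) :: int)"
        using finK P(1) Pne n by (subst sum.remove[of _ P]) auto
      moreover have "K - {{}} - {P} = K - {P} - {{}}" by auto
      ultimately show ?thesis unfolding * rsum by simp
    qed
    ultimately show ?thesis using r'(1) by (intro exI[of _ r']) simp
  qed
qed

section \<open>The value for spheres\<close>

lemma pure_complex_aff_dim_le:
  fixes D :: "'a::euclidean_space set set"
  assumes "pure_complex k D" "F \<in> D"
  shows "aff_dim F \<le> int k"
proof -
  obtain Q where "F face_of Q" "aff_dim Q = int k" using assms unfolding pure_complex_def by blast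
  then show ?thesis using aff_dim_subset[OF face_of_imp_subset] by metis
qed

lemma euler_char_sphere:
  fixes D :: "'a::euclidean_space set set"
  assumes D: "pure_complex (DIM('a) - 1) D" and sph: "\<Union>D homeomorphic sphere (0::'a) 1"
  shows "euler_char D = 1 + (-1) ^ (DIM('a) - 1)"
proof -
  have K: "polytopal_complex D" using D by (simp add: pure_complex_def)
  have finD: "finite D" by (rule polytopal_complexD(1)[OF K])
  have dim: "aff_dim F \<le> int (DIM('a) - 1)" if "F \<in> D" for F
    by (rule pure_complex_aff_dim_le[OF D that])
  have dim_pos: "DIM('a) > 0" by simp
  have ec: "euler_char D = (\<Sum>F\<in>D - {{}}. (-1) ^ nat (aff_dim F))"
    by (rule euler_char_eq_sum[OF finD]) (use dim dim_pos in \<open>force dest: dim\<close>)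
  show ?thesis
  \<comment> \<open>The sphere of dimension \<open>0\<close> is disconnected and its two classes
    share degree \<open>0\<close>; this case is settled by counting its two points.\<close>
  proof (cases "DIM('a) = 1")
    case True
    have single: "\<exists>x. F = {x}" if "F \<in> D - {{}}" for F
    proof -
      have "aff_dim F = 0" using dim[of F] that True aff_dim_nonneg[of F] by auto
      then show ?thesis by (simp add: aff_dim_eq_0)
    qed
    have "bij_betw (\<lambda>x. {x}) (\<Union>D) (D - {{}})"
      unfolding bij_betw_def
    proof
      show "(\<lambda>x. {x}) ` \<Union>D = D - {{}}"
      proof
        show "(\<lambda>x. {x}) ` \<Union>D \<subseteq> D - {{}}"
        proof
          fix y assume "y \<in> (\<lambda>x. {x}) ` \<Union>D"
          then obtain x F where xF: "y = {x}" "x \<in> F" "F \<in> D" by auto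
          then obtain z where "F = {z}" using single[of F] by auto
          then show "y \<in> D - {{}}" using xF by auto
        qed
        show "D - {{}} \<subseteq> (\<lambda>x. {x}) ` \<Union>D" using single by fastforce
      qed
    qed auto
    then have "card (\<Union>D) = card (D - {{}})" by (rule bij_betw_same_card)
    obtain b :: 'a where b: "Basis = {b}" using True by (metis card_1_singletonE)
    have nb: "norm b = 1" by (rule norm_Basis) (simp add: b)
    have "sphere (0::'a) 1 = {b, -b}"
    proof
      show "sphere (0::'a) 1 \<subseteq> {b, - b}"
      proof
        fix x :: 'a assume "x \<in> sphere 0 1"
        then have nx: "norm x = 1" by simp
        have x: "(x \<bullet> b) *\<^sub>R b = x" using euclidean_representation[of x] by (simp add: b)
        have "norm ((x \<bullet> b) *\<^sub>R b) = \<bar>x \<bullet> b\<bar>" using nb by simp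
        then have "\<bar>x \<bullet> b\<bar> = 1" using x nx by simp
        then have "x \<bullet> b = 1 \<or> x \<bullet> b = -1" by linarith
        then show "x \<in> {b, -b}" using x by auto
      qed
    qed (use nb in auto)
    moreover have "b \<noteq> - b"
    proof
      assume "b = - b"
      then have "b \<bullet> b = - (b \<bullet> b)" by (metis inner_minus_left)
      moreover have "b \<bullet> b = 1" using nb by (simp add: norm_eq_1)
      ultimately show False by simp
    qed
    ultimately have "card (sphere (0::'a) 1) = 2" by simp
    moreover have "card (\<Union>D) = card (sphere (0::'a) 1)"
    proof -
      obtain f g where fg: "homeomorphism (\<Union>D) (sphere (0::'a) 1) f g"
        using sph by (auto simp: homeomorphic_def)
      then have "inj_on f (\<Union>D)" by (auto simp: homeomorphism_def intro: inj_on_inverseI)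
      then show ?thesis using fg card_image by (fastforce simp: homeomorphism_def)
    qed
    ultimately have "card (D - {{}}) = 2" using \<open>card (\<Union>D) = card (D - {{}})\<close> by simp
    moreover have "(-1) ^ nat (aff_dim F) = (1::int)" if "F \<in> D - {{}}" for F
      using single[OF that] by auto
    ultimately show ?thesis unfolding ec using True by simp
  next
    case False
    then have d2: "2 \<le> DIM('a)" using dim_pos by linarith
    define n where "n = DIM('a) - 1"
    have n: "n \<ge> 1" "DIM('a) = Suc n" using d2 by (auto simp: n_def)
    obtain f :: "(nat \<Rightarrow> real) \<Rightarrow> 'a" and g where "homeomorphic_maps (nsphere n) (top_of_set (sphere 0 1 \<inter> span (Basis::'a set))) f g"
      using homeomorphic_maps_nsphere_euclidean_sphere[OF independent_Basis orthogonal_Basis refl, where 'n = 'a] norm_Basis n_def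
      by auto
    then have "nsphere n homeomorphic_space top_of_set (sphere (0::'a) 1)"
      by (auto simp: homeomorphic_space_def)
    moreover have "top_of_set (sphere (0::'a) 1) homeomorphic_space top_of_set (\<Union>D)"
      using sph homeomorphic_sym by auto
    ultimately have hs: "nsphere n homeomorphic_space top_of_set (\<Union>D)"
      using homeomorphic_space_trans by blast
    obtain r where r: "\<And>p. has_rank (homology_group p (top_of_set (\<Union>D))) (r p)"
      and rsum: "(\<Sum>k\<le>Suc DIM('a). (-1) ^ k * int (r (int k - 1))) = - (\<Sum>F\<in>D - {{}}. (-1) ^ nat (aff_dim F))"
      using euler_poincare[OF K] by blast
    \<comment> \<open>Reduced and unreduced homology agree outside degree \<open>0\<close>; degree
      \<open>0\<close> is taken from path-connectedness instead.\<close>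
    have red: "reduced_homology_group p (nsphere n) \<cong> homology_group p (top_of_set (\<Union>D))" if "p \<noteq> 0" for p
      using homeomorphic_space_imp_isomorphic_reduced_homology_groups[OF hs, of p]
      by (simp add: un_reduced_homology_group[OF that])
    have r0: "r 0 = 1"
    proof (rule has_rank_unique_integer[OF _ _ r])
      have "path_connected (sphere (0::'a) 1)" using path_connected_sphere[OF d2] by blast
      then have pc: "path_connected (\<Union>D)" using sph homeomorphic_path_connectedness by blast
      have "sphere (0::'a) 1 \<noteq> {}" by simp
      moreover obtain f g where "homeomorphism (\<Union>D) (sphere (0::'a) 1) f g"
        using sph by (auto simp: homeomorphic_def)
      then have "f ` \<Union>D = sphere 0 1" by (rule homeomorphism_image1)
      ultimately have "\<Union>D \<noteq> {}" by (metis image_is_empty)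
      then show "homology_group 0 (top_of_set (\<Union>D)) \<cong> integer_group"
        using pc path_connectedin_euclidean[of "\<Union>D"]
        by (intro isomorphic_integer_zeroth_homology_group) (simp_all add: path_connectedin_def del: path_connectedin_euclidean)
    qed simp
    have rn: "r (int n) = 1"
    proof (rule has_rank_unique_integer[OF _ _ r])
      show "homology_group (int n) (top_of_set (\<Union>D)) \<cong> integer_group"
        using n by (intro iso_trans[OF group.iso_sym[OF _ red] reduced_homology_group_nsphere(1)]) auto
    qed simp
    have rp: "r p = 0" if "p \<noteq> 0" "p \<noteq> int n" for p
    proof (rule has_rank_unique_trivial[OF _ _ r])
      show "trivial_group (homology_group p (top_of_set (\<Union>D)))"
        using isomorphic_group_triviality[OF red[OF that(1)]] reduced_homology_group_nsphere(2)[OF that(2)] by simp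
    qed simp
    have "(\<Sum>k\<le>Suc DIM('a). (-1) ^ k * int (r (int k - 1))) = (\<Sum>k\<in>{1, Suc n}. (-1) ^ k * int (r (int k - 1)))"
    proof (rule sum.mono_neutral_right)
      show "{1, Suc n} \<subseteq> {..Suc DIM('a)}" using n by auto
      show "\<forall>k\<in>{..Suc DIM('a)} - {1, Suc n}. (-1) ^ k * int (r (int k - 1)) = 0"
      proof
        fix k assume "k \<in> {..Suc DIM('a)} - {1, Suc n}"
        then have "r (int k - 1) = 0" by (intro rp) auto
        then show "(-1) ^ k * int (r (int k - 1)) = 0" by simp
      qed
    qed simp
    also have "\<dots> = - 1 - (-1) ^ n" using n r0 rn by simp
    finally show ?thesis using rsum ec n_def by simp
  qed
qed

section \<open>Local structure of a complex\<close>

text \<open>Equality of the germs of \<open>S\<close> at \<open>x\<close> and of \<open>T\<close> at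
  \<open>y\<close> after translation. With \<open>y = 0\<close> and \<open>T\<close> a cone it
  expresses a tangent cone; with \<open>y = x\<close> it compares two complexes near a
  point.\<close>

definition locally_eq :: "'a::real_normed_vector \<Rightarrow> 'a set \<Rightarrow> 'a \<Rightarrow> 'a set \<Rightarrow> bool" where
  "locally_eq x S y T \<longleftrightarrow> (\<forall>\<^sub>F v in nhds 0. x + v \<in> S \<longleftrightarrow> y + v \<in> T)"

lemma locally_eq_mem: "locally_eq x S y T \<Longrightarrow> x \<in> S \<longleftrightarrow> y \<in> T"
  unfolding locally_eq_def by (drule eventually_nhds_x_imp_x) simp

lemma locally_eq_uminus: "locally_eq x S y T \<Longrightarrow> locally_eq x (- S) y (- T)"
  unfolding locally_eq_def by simp

lemma locally_eq_ballD:
  assumes "locally_eq x S y T"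
  obtains e where "e > 0" "\<And>v. norm v < e \<Longrightarrow> x + v \<in> S \<longleftrightarrow> y + v \<in> T"
  using assms unfolding locally_eq_def eventually_nhds_metric by (auto simp: dist_norm)

lemma locally_eq_ballI:
  assumes "e > 0" "\<And>v. norm v < e \<Longrightarrow> x + v \<in> S \<longleftrightarrow> y + v \<in> T"
  shows "locally_eq x S y T"
  using assms unfolding locally_eq_def eventually_nhds_metric by (auto simp: dist_norm)

lemma locally_eq_interior:
  assumes "locally_eq x S y T"
  shows "locally_eq x (interior S) y (interior T)"
proof -
  obtain e where e: "e > 0" "\<And>v. norm v < e \<Longrightarrow> x + v \<in> S \<longleftrightarrow> y + v \<in> T"
    using locally_eq_ballD[OF assms] by blast
  have "(+) (y - x) ` (S \<inter> ball x e) = T \<inter> ball y e"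
  proof (intro equalityI subsetI)
    fix z assume "z \<in> (+) (y - x) ` (S \<inter> ball x e)"
    then obtain w where w: "z = y - x + w" "w \<in> S" "dist x w < e" by auto
    then have "z = y + (w - x)" "norm (w - x) < e" by (simp_all add: dist_norm norm_minus_commute)
    then show "z \<in> T \<inter> ball y e" using e(2)[of "w - x"] w(2) by (simp add: dist_norm norm_minus_commute)
  next
    fix z assume "z \<in> T \<inter> ball y e"
    then have "x + (z - y) \<in> S \<inter> ball x e" using e(2)[of "z - y"] by (auto simp: dist_norm norm_minus_commute)
    then show "z \<in> (+) (y - x) ` (S \<inter> ball x e)" by (rule rev_image_eqI) simp
  qed
  then have image: "(+) (y - x) ` (interior S \<inter> ball x e) = interior T \<inter> ball y e"
    using interior_translation[of "y - x" "S \<inter> ball x e"] by simp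
  have *: "w \<in> interior S \<inter> ball x e \<longleftrightarrow> y - x + w \<in> interior T \<inter> ball y e" for w
    unfolding image[symmetric] by (simp add: inj_image_mem_iff)
  show ?thesis
  proof (rule locally_eq_ballI[OF e(1)])
    fix v :: 'a assume "norm v < e"
    then show "x + v \<in> interior S \<longleftrightarrow> y + v \<in> interior T"
      using *[of "x + v"] by (simp add: dist_norm)
  qed
qed

lemma locally_eq_frontier:
  assumes "locally_eq x S y T"
  shows "x \<in> frontier S \<longleftrightarrow> y \<in> frontier T"
  using locally_eq_mem[OF locally_eq_interior[OF assms]]
    locally_eq_mem[OF locally_eq_interior[OF locally_eq_uminus[OF assms]]]
  by (auto simp: frontier_interiors)

text \<open>The cone is cut out by the inequalities of \<open>P\<close> that are tight on all of
  \<open>F\<close>. One that is tight at a single relative interior point of \<open>F\<close> is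
  tight on \<open>F\<close>, since its hyperplane meets \<open>P\<close> in a face; so the same
  \<open>T\<close> serves every such point.\<close>

lemma polytope_locally_cone:
  fixes P :: "'a::euclidean_space set"
  assumes P: "polytope P" and F: "F \<subseteq> P"
  shows "\<exists>T. (\<forall>c>0. \<forall>v\<in>T. c *\<^sub>R v \<in> T) \<and> (\<forall>x\<in>rel_interior F. locally_eq x P 0 T)"
proof -
  obtain H where H: "finite H \<and> P = \<Inter>H \<and> (\<forall>h\<in>H. \<exists>a b. a \<noteq> 0 \<and> h = {x. a \<bullet> x \<le> b})"
    using polytope_imp_polyhedron[OF P] unfolding polyhedron_def ..
  then have "\<forall>h\<in>H. \<exists>a b. h = {x. a \<bullet> x \<le> b}" by meson
  from bchoice[OF this] obtain a where "\<forall>h\<in>H. \<exists>b. h = {x. a h \<bullet> x \<le> b}" ..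
  from bchoice[OF this] obtain b where ab: "\<forall>h\<in>H. h = {x. a h \<bullet> x \<le> b h}" ..
  have memP: "x \<in> P \<longleftrightarrow> (\<forall>h\<in>H. a h \<bullet> x \<le> b h)" for x
  proof -
    have "x \<in> h \<longleftrightarrow> a h \<bullet> x \<le> b h" if "h \<in> H" for h
      using ab[rule_format, OF that] by (metis mem_Collect_eq)
    then show ?thesis using H by auto
  qed
  define active where "active h \<longleftrightarrow> (\<forall>y\<in>F. a h \<bullet> y = b h)" for h
  define T where "T = {v. \<forall>h\<in>H. active h \<longrightarrow> a h \<bullet> v \<le> 0}"
  have "locally_eq x P 0 T" if x: "x \<in> rel_interior F" for x
  proof -
    have xF: "x \<in> F" using x rel_interior_subset by blast
    have "\<forall>h\<in>H. \<forall>\<^sub>F v in nhds 0. a h \<bullet> (x + v) \<le> b h \<longleftrightarrow> (active h \<longrightarrow> a h \<bullet> v \<le> 0)"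
    proof
      fix h assume h: "h \<in> H"
      show "\<forall>\<^sub>F v in nhds 0. a h \<bullet> (x + v) \<le> b h \<longleftrightarrow> (active h \<longrightarrow> a h \<bullet> v \<le> 0)"
      proof (cases "active h")
        case True
        then show ?thesis using xF by (simp add: active_def inner_add_right)
      next
        case False
        have le: "a h \<bullet> y \<le> b h" if "y \<in> P" for y using memP that h by blast
        have "a h \<bullet> x \<noteq> b h"
        proof
          assume eq: "a h \<bullet> x = b h"
          have "(P \<inter> {y. a h \<bullet> y = b h}) face_of P"
            using polytope_imp_convex[OF P] le by (rule face_of_Int_supporting_hyperplane_le)
          then have "F \<subseteq> P \<inter> {y. a h \<bullet> y = b h}"
            by (rule subset_of_face_of[OF _ F]) (use x xF eq F in blast)
          then show False using False by (auto simp: active_def)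
        qed
        then have lt: "a h \<bullet> (x + 0) < b h" using le[of x] xF F by auto
        have "((\<lambda>v. a h \<bullet> (x + v)) \<longlongrightarrow> a h \<bullet> (x + 0)) (nhds 0)"
          by (intro tendsto_intros filterlim_ident)
        then have "\<forall>\<^sub>F v in nhds 0. a h \<bullet> (x + v) < b h" using lt by (rule order_tendstoD)
        then show ?thesis using False by (auto elim: eventually_mono)
      qed
    qed
    then have "\<forall>\<^sub>F v in nhds 0. \<forall>h\<in>H. a h \<bullet> (x + v) \<le> b h \<longleftrightarrow> (active h \<longrightarrow> a h \<bullet> v \<le> 0)"
      by (rule eventually_ball_finite[OF conjunct1[OF H]])
    then show ?thesis
      unfolding locally_eq_def by (rule eventually_mono) (auto simp: memP T_def)
  qed
  moreover have "c *\<^sub>R v \<in> T" if "c > 0" "v \<in> T" for c v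
    using that by (auto simp: T_def mult_nonneg_nonpos)
  ultimately show ?thesis by blast
qed

text \<open>\<open>P \<inter> F\<close> is a face of \<open>F\<close> that meets its relative
  interior, hence it is \<open>F\<close>.\<close>

lemma polytopal_complex_rel_interior_mem:
  assumes K: "polytopal_complex K" and F: "F \<in> K" and P: "P \<in> K" and x: "x \<in> rel_interior F" "x \<in> P"
  shows "F face_of P"
proof -
  have "F \<subseteq> P \<inter> F"
    using subset_of_face_of[OF polytopal_complexD(5)[OF K P F], of F] x rel_interior_subset by blast
  then have "P \<inter> F = F" by blast
  then show ?thesis using polytopal_complexD(4)[OF K P F] by simp
qed

text \<open>Cells not containing \<open>F\<close> are closed and miss its relative interior, so
  finitely many cones, those of the cells containing \<open>F\<close>, describe the complex
  there.\<close>

lemma complex_locally_cone: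
  fixes K :: "'a::euclidean_space set set"
  assumes K: "polytopal_complex K" and F: "F \<in> K"
  obtains T where "\<And>c v. c > 0 \<Longrightarrow> v \<in> T \<Longrightarrow> c *\<^sub>R v \<in> T" "\<And>x. x \<in> rel_interior F \<Longrightarrow> locally_eq x (\<Union>K) 0 T"
proof -
  have "\<forall>P\<in>{P \<in> K. F \<subseteq> P}. \<exists>T. (\<forall>c>0. \<forall>v\<in>T. c *\<^sub>R v \<in> T) \<and> (\<forall>x\<in>rel_interior F. locally_eq x P 0 T)"
    using polytope_locally_cone polytopal_complexD(2)[OF K] by blast
  from bchoice[OF this] obtain T where
    T0: "\<forall>P\<in>{P \<in> K. F \<subseteq> P}. (\<forall>c>0. \<forall>v\<in>T P. c *\<^sub>R v \<in> T P) \<and> (\<forall>x\<in>rel_interior F. locally_eq x P 0 (T P))" ..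
  then have T: "\<And>P. P \<in> K \<Longrightarrow> F \<subseteq> P \<Longrightarrow> (\<forall>c>0. \<forall>v\<in>T P. c *\<^sub>R v \<in> T P)"
      "\<And>P x. P \<in> K \<Longrightarrow> F \<subseteq> P \<Longrightarrow> x \<in> rel_interior F \<Longrightarrow> locally_eq x P 0 (T P)"
    by simp_all
  define U where "U = (\<Union>P\<in>{P \<in> K. F \<subseteq> P}. T P)"
  show ?thesis
  proof
    show "c *\<^sub>R v \<in> U" if "c > 0" "v \<in> U" for c v using that T(1) by (auto simp: U_def)
    show "locally_eq x (\<Union>K) 0 U" if x: "x \<in> rel_interior F" for x
    proof -
      have "\<forall>P\<in>K. \<forall>\<^sub>F v in nhds 0. x + v \<in> P \<longleftrightarrow> (F \<subseteq> P \<and> v \<in> T P)"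
      proof
        fix P assume P: "P \<in> K"
        show "\<forall>\<^sub>F v in nhds 0. x + v \<in> P \<longleftrightarrow> (F \<subseteq> P \<and> v \<in> T P)"
        proof (cases "F \<subseteq> P")
          case True
          then show ?thesis using T(2)[OF P True x] by (simp add: locally_eq_def)
        next
          case False
          then have "x \<notin> P"
            using polytopal_complex_rel_interior_mem[OF K F P x] face_of_imp_subset by blast
          then have "open (- P)" "x + 0 \<in> - P"
            using polytopal_complexD(2)[OF K P] polytope_imp_closed by auto
          moreover have "((\<lambda>v. x + v) \<longlongrightarrow> x + 0) (nhds 0)" by (intro tendsto_intros filterlim_ident)
          ultimately have "\<forall>\<^sub>F v in nhds 0. x + v \<in> - P" by (metis topological_tendstoD)
          then show ?thesis using False by (auto elim: eventually_mono)
        qed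
      qed
      then have "\<forall>\<^sub>F v in nhds 0. \<forall>P\<in>K. x + v \<in> P \<longleftrightarrow> (F \<subseteq> P \<and> v \<in> T P)"
        by (rule eventually_ball_finite[OF polytopal_complexD(1)[OF K]])
      then show ?thesis unfolding locally_eq_def by (rule eventually_mono) (auto simp: U_def)
    qed
  qed
qed

text \<open>Among the cells through \<open>x\<close> take one of least dimension: were
  \<open>x\<close> on its relative frontier, a proper face through \<open>x\<close> would have
  smaller dimension.\<close>

lemma complex_rel_interior_cover:
  fixes K :: "'a::euclidean_space set set"
  assumes K: "polytopal_complex K" and x: "x \<in> \<Union>K"
  obtains F where "F \<in> K" "x \<in> rel_interior F"
proof -
  define m where "m = (LEAST m. \<exists>F\<in>K. x \<in> F \<and> nat (aff_dim F) = m)"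
  have "\<exists>m. \<exists>F\<in>K. x \<in> F \<and> nat (aff_dim F) = m" using x by blast
  then have "\<exists>F\<in>K. x \<in> F \<and> nat (aff_dim F) = m" unfolding m_def by (rule LeastI_ex)
  then obtain F where F: "F \<in> K" "x \<in> F" "nat (aff_dim F) = m" by blast
  have "x \<in> rel_interior F"
  proof (rule ccontr)
    assume "x \<notin> rel_interior F"
    then have "x \<in> rel_frontier F" using F(2) closure_subset by (auto simp: rel_frontier_def)
    then obtain G where G: "G face_of F" "G \<noteq> F" "x \<in> G"
      using rel_frontier_of_polyhedron_alt[of F] polytope_imp_polyhedron polytopal_complexD(2)[OF K F(1)] by blast
    have "aff_dim G < aff_dim F"
      using G polytope_imp_convex polytopal_complexD(2)[OF K F(1)] by (intro face_of_aff_dim_lt) auto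
    moreover have "0 \<le> aff_dim G" using G(3) by (intro aff_dim_nonneg) auto
    ultimately have "nat (aff_dim G) < m" using F(3) by linarith
    moreover have "m \<le> nat (aff_dim G)"
      unfolding m_def using G polytopal_complexD(3)[OF K F(1) G(1)] by (intro Least_le) blast
    ultimately show False by simp
  qed
  then show ?thesis using that F by blast
qed

lemma complex_closed: "polytopal_complex K \<Longrightarrow> closed (\<Union>K)"
  by (intro closed_Union) (auto simp: polytopal_complex_def polytope_imp_closed)

lemma closure_rel_interior_polytope:
  fixes F :: "'a::euclidean_space set"
  shows "polytope F \<Longrightarrow> closure (rel_interior F) = F"
  using convex_closure_rel_interior[of F] polytope_imp_convex[of F] polytope_imp_closed[of F]
  by (simp add: closure_closed)

text \<open>Along the relative interior of \<open>F\<close> the complex has one and the same cone,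
  so either all of these points are on the frontier or none is.\<close>

lemma boundary_complex_iff:
  fixes K :: "'a::euclidean_space set set"
  assumes K: "polytopal_complex K" and F: "F \<in> K" and x: "x \<in> rel_interior F"
  shows "F \<in> boundary_complex K \<longleftrightarrow> x \<in> frontier (\<Union>K)"
proof
  assume "F \<in> boundary_complex K"
  then show "x \<in> frontier (\<Union>K)" using x rel_interior_subset by (auto simp: boundary_complex_def)
next
  assume xf: "x \<in> frontier (\<Union>K)"
  obtain T where T: "\<And>x. x \<in> rel_interior F \<Longrightarrow> locally_eq x (\<Union>K) 0 T"
    using complex_locally_cone[OF K F] by metis
  have "rel_interior F \<subseteq> frontier (\<Union>K)"
    using locally_eq_frontier[OF T[OF x]] locally_eq_frontier[OF T] xf by blast
  then have "closure (rel_interior F) \<subseteq> frontier (\<Union>K)"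
    by (intro closure_minimal) auto
  then show "F \<in> boundary_complex K"
    using F closure_rel_interior_polytope[OF polytopal_complexD(2)[OF K F]] by (simp add: boundary_complex_def)
qed

lemma Union_boundary_complex:
  fixes K :: "'a::euclidean_space set set"
  assumes K: "polytopal_complex K"
  shows "\<Union>(boundary_complex K) = frontier (\<Union>K)"
proof
  show "\<Union>(boundary_complex K) \<subseteq> frontier (\<Union>K)" by (auto simp: boundary_complex_def)
  show "frontier (\<Union>K) \<subseteq> \<Union>(boundary_complex K)"
  proof
    fix x assume x: "x \<in> frontier (\<Union>K)"
    then have "x \<in> \<Union>K" using complex_closed[OF K] frontier_subset_closed by blast
    then obtain F where F: "F \<in> K" "x \<in> rel_interior F" using complex_rel_interior_cover[OF K] by blast
    then have "F \<in> boundary_complex K" using boundary_complex_iff[OF K] x by blast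
    then show "x \<in> \<Union>(boundary_complex K)" using F rel_interior_subset by blast
  qed
qed

lemma complex_frontier_negligible:
  fixes K :: "'a::euclidean_space set set"
  assumes K: "polytopal_complex K"
  shows "negligible (frontier (\<Union>K))"
proof (rule negligible_subset)
  show "frontier (\<Union>K) \<subseteq> (\<Union>P\<in>K. frontier P)"
    using frontier_Union_subset polytopal_complexD(1)[OF K] by blast
  show "negligible (\<Union>P\<in>K. frontier P)"
    using K by (intro negligible_Union) (auto simp: polytopal_complex_def polytope_imp_convex negligible_convex_frontier)
qed

lemma aff_dim_less_if_subset_frontier:
  fixes F :: "'a::euclidean_space set"
  assumes "convex F" "F \<subseteq> S" "F \<subseteq> frontier S"
  shows "aff_dim F < int DIM('a)"
proof (rule ccontr)
  assume "\<not> aff_dim F < int DIM('a)"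
  then have full: "aff_dim F = int DIM('a)" using aff_dim_le_DIM[of F] by linarith
  then have "affine hull F = UNIV" by (simp add: aff_dim_eq_full)
  then have "rel_interior F = interior F" by (rule rel_interior_interior)
  moreover have "F \<noteq> {}" using full by auto
  ultimately have "interior F \<noteq> {}" using rel_interior_eq_empty[OF assms(1)] by simp
  moreover have "interior F \<subseteq> interior S" using assms(2) by (rule interior_mono)
  ultimately show False using assms(3) interior_subset by (fastforce simp: frontier_def)
qed

section \<open>Solid angles\<close>

lemma measure_local_cone:
  fixes S T :: "'a::euclidean_space set"
  assumes T: "\<And>c v. c > 0 \<Longrightarrow> v \<in> T \<Longrightarrow> c *\<^sub>R v \<in> T" and r: "r > 0"
    and S: "\<And>v. norm v \<le> r \<Longrightarrow> x + v \<in> S \<longleftrightarrow> v \<in> T"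
  shows "measure lebesgue (S \<inter> cball x r) = r ^ DIM('a) * measure lebesgue (T \<inter> cball 0 1)"
proof -
  have "S \<inter> cball x r = (\<lambda>v. r *\<^sub>R v + x) ` (T \<inter> cball 0 1)"
  proof (intro equalityI subsetI)
    fix y assume y: "y \<in> S \<inter> cball x r"
    define v where "v = (1 / r) *\<^sub>R (y - x)"
    have nv: "norm (y - x) \<le> r" using y by (simp add: dist_norm norm_minus_commute)
    then have "y - x \<in> T" using S[of "y - x"] y by simp
    then have "v \<in> T" using T[of "1 / r"] r by (simp add: v_def)
    moreover have "norm v \<le> 1" using nv r by (simp add: v_def divide_simps)
    moreover have "y = r *\<^sub>R v + x" using r by (simp add: v_def)
    ultimately show "y \<in> (\<lambda>v. r *\<^sub>R v + x) ` (T \<inter> cball 0 1)" by (intro image_eqI[of _ _ v]) auto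
  next
    fix y assume "y \<in> (\<lambda>v. r *\<^sub>R v + x) ` (T \<inter> cball 0 1)"
    then obtain v where "v \<in> T \<inter> cball 0 1" "y = r *\<^sub>R v + x" by blast
    then have v: "y = x + r *\<^sub>R v" "v \<in> T" "norm v \<le> 1" by simp_all
    then have "norm (r *\<^sub>R v) \<le> r" using r by (simp add: mult_left_le)
    moreover have "r *\<^sub>R v \<in> T" using T r v by blast
    ultimately show "y \<in> S \<inter> cball x r" using S[of "r *\<^sub>R v"] v by (simp add: dist_norm)
  qed
  then show ?thesis
    using measure_lebesgue_affine[of r x "T \<inter> cball 0 1"] r by simp
qed

text \<open>The cone over the spherical part of \<open>S\<close> with apex \<open>x\<close> is
  \<open>S \<inter> cball x r\<close> up to the point \<open>x\<close>, so areas on spheres become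
  volumes of balls.\<close>

lemma sphere_vol_local_cone:
  fixes S T :: "'a::euclidean_space set"
  assumes T: "\<And>c v. c > 0 \<Longrightarrow> v \<in> T \<Longrightarrow> c *\<^sub>R v \<in> T" and r: "r > 0"
    and S: "\<And>v. norm v \<le> r \<Longrightarrow> x + v \<in> S \<longleftrightarrow> v \<in> T" and "open S"
  shows "sphere_vol x r (sphere x r \<inter> S) = DIM('a) / r * measure lebesgue (S \<inter> cball x r)"
proof -
  let ?C = "{x + t *\<^sub>R (y - x) | t y. 0 \<le> t \<and> t \<le> 1 \<and> y \<in> sphere x r \<inter> S}"
  have "measure lebesgue ?C = measure lebesgue (S \<inter> cball x r)"
  proof (rule measure_negligible_symdiff)
    show "S \<inter> cball x r \<in> lmeasurable"
      using \<open>open S\<close> by (intro bounded_set_imp_lmeasurable) (auto intro: bounded_Int)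
    have 1: "p \<in> S \<inter> cball x r" if "p \<in> ?C" "p \<noteq> x" for p
    proof -
      obtain t y where p: "p = x + t *\<^sub>R (y - x)" "0 \<le> t" "t \<le> 1" "y \<in> S" "norm (y - x) = r"
        using \<open>p \<in> ?C\<close> by (auto simp: dist_norm norm_minus_commute)
      then have "t > 0" using \<open>p \<noteq> x\<close> by (cases "t = 0") auto
      have "y - x \<in> T" using S[of "y - x"] p by simp
      then have "t *\<^sub>R (y - x) \<in> T" using T \<open>t > 0\<close> by blast
      moreover have "norm (t *\<^sub>R (y - x)) \<le> r" using p r by (simp add: mult_left_le_one_le)
      ultimately show ?thesis using S[of "t *\<^sub>R (y - x)"] p(1) by (simp add: dist_norm)
    qed
    have 2: "p \<in> ?C" if p: "p \<in> S \<inter> cball x r" "p \<noteq> x" for p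
    proof -
      define w where "w = p - x"
      have w: "norm w > 0" "norm w \<le> r" using p by (auto simp: w_def dist_norm norm_minus_commute)
      then have "w \<in> T" using S[of w] p by (simp add: w_def)
      then have wT: "(r / norm w) *\<^sub>R w \<in> T" using T w r by simp
      have nw: "norm ((r / norm w) *\<^sub>R w) = r" using w r by simp
      have "x + (r / norm w) *\<^sub>R w \<in> S" using S[of "(r / norm w) *\<^sub>R w"] nw wT by simp
      moreover have "p = x + (norm w / r) *\<^sub>R ((x + (r / norm w) *\<^sub>R w) - x)"
        using w r by (simp add: w_def)
      moreover have "0 \<le> norm w / r" "norm w / r \<le> 1" using w r by auto
      moreover have "x + (r / norm w) *\<^sub>R w \<in> sphere x r" using nw by (simp add: dist_norm)
      ultimately show ?thesis by blast
    qed
    have "(S \<inter> cball x r) - ?C \<union> (?C - (S \<inter> cball x r)) \<subseteq> {x}" using 1 2 by blast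
    then show "negligible ((S \<inter> cball x r) - ?C \<union> (?C - (S \<inter> cball x r)))"
      by (rule negligible_subset[OF negligible_sing])
  qed
  then show ?thesis by (simp add: sphere_vol_def)
qed

lemma interior_cone:
  fixes T :: "'a::real_normed_vector set"
  assumes T: "\<And>c v. c > 0 \<Longrightarrow> v \<in> T \<Longrightarrow> c *\<^sub>R v \<in> T" and c: "c > 0" and v: "v \<in> interior T"
  shows "c *\<^sub>R v \<in> interior T"
proof -
  have "(*\<^sub>R) c ` interior T \<subseteq> T" using T[OF c] interior_subset by blast
  moreover have "open ((*\<^sub>R) c ` interior T)" using c by (intro open_scaling) auto
  ultimately have "(*\<^sub>R) c ` interior T \<subseteq> interior T" by (rule interior_maximal)
  then show ?thesis using v by blast
qed

text \<open>Shows that the description in \<open>solid_angle\<close> denotes: near every relative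
  interior point of \<open>F\<close> the interior of the complex is the same cone, so the ratio is
  one constant for all small radii. The conclusion is phrased with balls, where measures
  add.\<close>

lemma solid_angle_complex:
  fixes K :: "'a::euclidean_space set set"
  assumes K: "polytopal_complex K" and F: "F \<in> K" and x: "x \<in> rel_interior F"
  shows "\<forall>\<^sub>F r in at_right 0. measure lebesgue (interior (\<Union>K) \<inter> cball x r)
    = solid_angle F K * measure lebesgue (cball x r)"
proof -
  obtain T0 where T0: "\<And>c v. c > 0 \<Longrightarrow> v \<in> T0 \<Longrightarrow> c *\<^sub>R v \<in> T0"
    "\<And>x. x \<in> rel_interior F \<Longrightarrow> locally_eq x (\<Union>K) 0 T0"
    using complex_locally_cone[OF K F] by metis
  define T where "T = interior T0"
  define S where "S = interior (\<Union>K)"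
  define \<alpha> where "\<alpha> = measure lebesgue (T \<inter> cball 0 1) / measure lebesgue (cball (0::'a) 1)"
  have T: "\<And>c v. c > 0 \<Longrightarrow> v \<in> T \<Longrightarrow> c *\<^sub>R v \<in> T"
    unfolding T_def using interior_cone T0(1) by blast
  have pos: "measure lebesgue (cball (0::'a) 1) > 0"
    using content_cball_pos[of 1 "0::'a"] by simp
  \<comment> \<open>\<open>UNIV\<close> is a cone as well; its instances supply the
    denominators.\<close>
  have full: "measure lebesgue (cball y r) = r ^ DIM('a) * measure lebesgue (cball (0::'a) 1)" if "r > 0" for y :: 'a and r
    using measure_local_cone[of UNIV r y UNIV] that by simp
  have fullsph: "sphere_vol y r (sphere y r) = DIM('a) / r * measure lebesgue (cball y r)" if "r > 0" for y :: 'a and r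
    using sphere_vol_local_cone[of UNIV r y UNIV] that by simp
  have ev: "\<forall>\<^sub>F r in at_right 0. r > 0 \<and> (\<forall>v. norm v \<le> r \<longrightarrow> y + v \<in> S \<longleftrightarrow> v \<in> T)"
    if "y \<in> rel_interior F" for y
  proof -
    have "locally_eq y S 0 T" unfolding S_def T_def by (rule locally_eq_interior[OF T0(2)[OF that]])
    then obtain e where "e > 0" "\<And>v. norm v < e \<Longrightarrow> y + v \<in> S \<longleftrightarrow> 0 + v \<in> T"
      using locally_eq_ballD by blast
    then show ?thesis
      unfolding eventually_at_right_field by (intro exI[of _ e]) auto
  qed
  have meas: "measure lebesgue (S \<inter> cball y r) = \<alpha> * measure lebesgue (cball y r)"
    if "r > 0 \<and> (\<forall>v. norm v \<le> r \<longrightarrow> y + v \<in> S \<longleftrightarrow> v \<in> T)" for y r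
    using measure_local_cone[of T r y S] T that full[of r y] pos by (simp add: \<alpha>_def)
  have ratio: "sphere_vol y r (sphere y r \<inter> S) / sphere_vol y r (sphere y r) = \<alpha>"
    if r: "r > 0 \<and> (\<forall>v. norm v \<le> r \<longrightarrow> y + v \<in> S \<longleftrightarrow> v \<in> T)" for y r
  proof -
    have "sphere_vol y r (sphere y r \<inter> S) = DIM('a) / r * (\<alpha> * measure lebesgue (cball y r))"
      using sphere_vol_local_cone[of T r y S] T r meas[OF r] by (simp add: S_def)
    moreover have "DIM('a) / r * measure lebesgue (cball y r) \<noteq> 0"
      using r full[of r y] pos by simp
    ultimately show ?thesis using fullsph[of r y] r by simp
  qed
  have "solid_angle F K = \<alpha>"
    unfolding solid_angle_def
  proof (rule the_equality)
    show "\<forall>x\<in>rel_interior F. \<forall>\<^sub>F \<epsilon> in at_right 0.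
        sphere_vol x \<epsilon> (sphere x \<epsilon> \<inter> interior (\<Union>K)) / sphere_vol x \<epsilon> (sphere x \<epsilon>) = \<alpha>"
      unfolding S_def[symmetric] by (intro ballI eventually_mono[OF ev]) (assumption, rule ratio)
    \<comment> \<open>The point \<open>x\<close> keeps the condition from being vacuous, and a
      constant that holds eventually at the nontrivial filter \<open>at_right 0\<close> is
      determined.\<close>
    show "a = \<alpha>" if a: "\<forall>x\<in>rel_interior F. \<forall>\<^sub>F \<epsilon> in at_right 0.
        sphere_vol x \<epsilon> (sphere x \<epsilon> \<inter> interior (\<Union>K)) / sphere_vol x \<epsilon> (sphere x \<epsilon>) = a" for a
    proof -
      have "\<forall>\<^sub>F \<epsilon> in at_right 0. sphere_vol x \<epsilon> (sphere x \<epsilon> \<inter> S) / sphere_vol x \<epsilon> (sphere x \<epsilon>) = a"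
        using a x by (simp add: S_def)
      moreover have "\<forall>\<^sub>F \<epsilon> in at_right 0. sphere_vol x \<epsilon> (sphere x \<epsilon> \<inter> S) / sphere_vol x \<epsilon> (sphere x \<epsilon>) = \<alpha>"
        by (rule eventually_mono[OF ev[OF x]]) (rule ratio)
      ultimately have "\<forall>\<^sub>F \<epsilon> in at_right (0::real). a = \<alpha>" by eventually_elim simp
      then show ?thesis by simp
    qed
  qed
  moreover have "\<forall>\<^sub>F r in at_right 0. measure lebesgue (S \<inter> cball x r) = \<alpha> * measure lebesgue (cball x r)"
    by (rule eventually_mono[OF ev[OF x]]) (rule meas)
  ultimately show ?thesis by (simp add: S_def)
qed

lemma eventually_cball_subset:
  assumes "open U" "x \<in> U"
  shows "\<forall>\<^sub>F r in at_right 0. 0 < r \<and> cball x r \<subseteq> U"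
proof -
  obtain e where "e > 0" "ball x e \<subseteq> U" using assms open_contains_ball by blast
  then show ?thesis
    unfolding eventually_at_right_field by (intro exI[of _ e]) (auto simp: subset_iff)
qed

lemma solid_angle_cong:
  fixes K L :: "'a::euclidean_space set set"
  assumes K: "polytopal_complex K" "F \<in> K" and L: "polytopal_complex L" "F \<in> L"
    and x: "x \<in> rel_interior F" and U: "open U" "x \<in> U" "\<Union>K \<inter> U = \<Union>L \<inter> U"
  shows "solid_angle F K = solid_angle F L"
proof -
  have eq: "interior (\<Union>K) \<inter> U = interior (\<Union>L) \<inter> U"
    using U interior_Int[of "\<Union>K" U] interior_Int[of "\<Union>L" U] by (simp add: interior_open)
  \<comment> \<open>The equation does not mention \<open>r\<close>, so one sufficiently small radius
    proves it.\<close>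
  have "\<forall>\<^sub>F r in at_right (0::real). solid_angle F K = solid_angle F L"
    using solid_angle_complex[OF K x] solid_angle_complex[OF L x] eventually_cball_subset[OF U(1,2)]
  proof (eventually_elim)
    case (elim r)
    then have "interior (\<Union>K) \<inter> cball x r = interior (\<Union>L) \<inter> cball x r" using eq by blast
    then have "solid_angle F K * measure lebesgue (cball x r) = solid_angle F L * measure lebesgue (cball x r)"
      using elim by simp
    moreover have "measure lebesgue (cball x r) > 0" using elim content_cball_pos[of r x] by simp
    ultimately show ?case using elim by simp
  qed
  then show ?thesis by simp
qed

text \<open>A small ball around \<open>x\<close> is the disjoint union of its parts in the two
  interiors, up to the frontiers, which are negligible.\<close>

lemma solid_angle_add:
  fixes A B :: "'a::euclidean_space set set"
  assumes A: "polytopal_complex A" "F \<in> A" and B: "polytopal_complex B" "F \<in> B"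
    and x: "x \<in> rel_interior F" "x \<in> interior (\<Union>A \<union> \<Union>B)"
    and disj: "interior (\<Union>A) \<inter> interior (\<Union>B) = {}"
  shows "solid_angle F A + solid_angle F B = 1"
proof -
  have "\<forall>\<^sub>F r in at_right (0::real). solid_angle F A + solid_angle F B = 1"
    using solid_angle_complex[OF A x(1)] solid_angle_complex[OF B x(1)]
      eventually_cball_subset[OF open_interior x(2)]
  proof eventually_elim
    case (elim r)
    let ?A = "interior (\<Union>A) \<inter> cball x r" and ?B = "interior (\<Union>B) \<inter> cball x r"
    have lm: "?A \<in> lmeasurable" "?B \<in> lmeasurable"
      by (intro bounded_set_imp_lmeasurable; auto intro: bounded_Int)+
    have sub: "cball x r \<subseteq> \<Union>A \<union> \<Union>B" using elim interior_subset by blast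
    have "?A \<union> ?B - cball x r \<union> (cball x r - (?A \<union> ?B)) \<subseteq> frontier (\<Union>A) \<union> frontier (\<Union>B)"
    proof
      fix y assume "y \<in> ?A \<union> ?B - cball x r \<union> (cball x r - (?A \<union> ?B))"
      then have y: "y \<in> cball x r" "y \<notin> interior (\<Union>A)" "y \<notin> interior (\<Union>B)" by blast+
      then have "y \<in> \<Union>A \<or> y \<in> \<Union>B" using sub by blast
      then have "y \<in> closure (\<Union>A) \<or> y \<in> closure (\<Union>B)"
        using closure_subset[of "\<Union>A"] closure_subset[of "\<Union>B"] by blast
      then show "y \<in> frontier (\<Union>A) \<union> frontier (\<Union>B)" using y by (auto simp: frontier_def)
    qed
    then have "negligible (?A \<union> ?B - cball x r \<union> (cball x r - (?A \<union> ?B)))"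
      by (rule negligible_subset[rotated])
         (intro negligible_Un complex_frontier_negligible[OF A(1)] complex_frontier_negligible[OF B(1)])
    then have "measure lebesgue (cball x r) = measure lebesgue (?A \<union> ?B)"
      using lm by (intro measure_negligible_symdiff) auto
    also have "\<dots> = measure lebesgue ?A + measure lebesgue ?B"
    proof -
      have "?A \<inter> ?B = {}" using disj by blast
      then show ?thesis using measure_Un3[OF lm] by simp
    qed
    finally have "(solid_angle F A + solid_angle F B) * measure lebesgue (cball x r) = 1 * measure lebesgue (cball x r)"
      using elim by (simp add: algebra_simps)
    moreover have "measure lebesgue (cball x r) > 0" using elim content_cball_pos[of r x] by simp
    ultimately show ?case by simp
  qed
  then show ?thesis by simp
qed

section \<open>Cells along a gluing\<close>

text \<open>An open half-ball is connected and misses the frontier of \<open>S\<close>, so a single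
  point of \<open>S\<close> in it puts all of it into \<open>S\<close>. Such a point exists because
  an open set does not fit into a hyperplane.\<close>

lemma half_ball_subset:
  fixes S :: "'a::euclidean_space set"
  assumes fr: "ball z e \<inter> frontier S \<subseteq> {y. a \<bullet> y = b}" and a: "a \<noteq> 0"
    and ne: "interior S \<inter> ball z e \<noteq> {}"
  shows "ball z e \<inter> {y. a \<bullet> y < b} \<subseteq> S \<or> ball z e \<inter> {y. a \<bullet> y > b} \<subseteq> S"
proof -
  have "\<not> interior S \<inter> ball z e \<subseteq> {y. a \<bullet> y = b}"
  proof
    assume "interior S \<inter> ball z e \<subseteq> {y. a \<bullet> y = b}"
    then have "interior S \<inter> ball z e \<subseteq> interior {y. a \<bullet> y = b}" by (intro interior_maximal) auto
    then show False using ne interior_hyperplane[OF a] by blast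
  qed
  then obtain p where p: "p \<in> S" "p \<in> ball z e" "a \<bullet> p \<noteq> b" using interior_subset by blast
  have side: "D \<subseteq> S" if "convex D" "p \<in> D" "D \<subseteq> ball z e" "D \<inter> {y. a \<bullet> y = b} = {}" for D
    using connected_Int_frontier[OF convex_connected[OF that(1)], of S] that p fr by blast
  show ?thesis
  proof (cases "a \<bullet> p < b")
    case True
    have "ball z e \<inter> {y. a \<bullet> y < b} \<subseteq> S"
      by (rule side) (use True p in \<open>auto intro: convex_Int convex_halfspace_lt\<close>)
    then show ?thesis ..
  next
    case False
    have "ball z e \<inter> {y. a \<bullet> y > b} \<subseteq> S"
      by (rule side) (use False p in \<open>auto intro: convex_Int convex_halfspace_gt\<close>)
    then show ?thesis ..
  qed
qed

text \<open>Each of \<open>S\<close> and \<open>T\<close> contains an open half-ball, and no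
  half-ball is in both as \<open>S \<inter> T\<close> is flat; so they occupy opposite
  sides.\<close>

lemma ball_subset_Un_two_sides:
  fixes S T :: "'a::euclidean_space set"
  assumes cl: "closed S" "closed T" and a: "a \<noteq> 0" "a \<bullet> z = b" and e: "e > 0"
    and S: "ball z e \<inter> frontier S \<subseteq> {y. a \<bullet> y = b}" "interior S \<inter> ball z e \<noteq> {}"
    and T: "ball z e \<inter> frontier T \<subseteq> {y. a \<bullet> y = b}" "interior T \<inter> ball z e \<noteq> {}"
    and ST: "ball z e \<inter> (S \<inter> T) \<subseteq> {y. a \<bullet> y = b}"
  shows "ball z e \<subseteq> S \<union> T"
proof -
  \<comment> \<open>A step of length \<open>e / 2\<close> along the normal, witnessing that both
    half-balls are nonempty.\<close>
  define \<delta> where "\<delta> = e / (2 * norm a)"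
  have \<delta>: "\<delta> > 0" "\<delta> * norm a < e" using e a by (auto simp: \<delta>_def)
  have "z + \<delta> *\<^sub>R a \<in> ball z e \<inter> {y. a \<bullet> y > b}" "z - \<delta> *\<^sub>R a \<in> ball z e \<inter> {y. a \<bullet> y < b}"
    using \<delta> a by (auto simp: dist_norm inner_add_right inner_diff_right)
  moreover have "ball z e \<inter> (S \<inter> T) \<inter> {y. a \<bullet> y > b} = {}" "ball z e \<inter> (S \<inter> T) \<inter> {y. a \<bullet> y < b} = {}"
    using ST by force+
  ultimately have "\<not> ball z e \<inter> {y. a \<bullet> y > b} \<subseteq> S \<inter> T" "\<not> ball z e \<inter> {y. a \<bullet> y < b} \<subseteq> S \<inter> T"
    by blast+
  then have "ball z e \<inter> {y. a \<bullet> y < b} \<subseteq> S \<union> T" "ball z e \<inter> {y. a \<bullet> y > b} \<subseteq> S \<union> T"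
    using half_ball_subset[OF S(1) a(1) S(2)] half_ball_subset[OF T(1) a(1) T(2)] by blast+
  moreover have "ball z e \<subseteq> (ball z e \<inter> {y. a \<bullet> y < b}) \<union> (ball z e \<inter> {y. a \<bullet> y > b}) \<union> {y. a \<bullet> y = b}"
    by auto
  \<comment> \<open>What remains uncovered is open but lies in a hyperplane, so it is empty.\<close>
  ultimately have "ball z e - (S \<union> T) \<subseteq> {y. a \<bullet> y = b}" by blast
  moreover have "open (ball z e - (S \<union> T))" using cl by (intro open_Diff closed_Un) auto
  ultimately have "ball z e - (S \<union> T) \<subseteq> interior {y. a \<bullet> y = b}" by (rule interior_maximal)
  then show ?thesis using interior_hyperplane[OF a(1)] by blast
qed

lemma convex_full_dim_interior:
  fixes Q :: "'a::euclidean_space set"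
  assumes "convex Q" "aff_dim Q = int DIM('a)"
  shows "interior Q \<noteq> {}"
proof -
  have "affine hull Q = UNIV" using assms(2) by (simp add: aff_dim_eq_full)
  then have "rel_interior Q = interior Q" by (rule rel_interior_interior)
  moreover have "Q \<noteq> {}" using assms(2) by auto
  ultimately show ?thesis using rel_interior_eq_empty[OF assms(1)] by simp
qed

text \<open>By purity every point lies in a full-dimensional cell, which is contained in the closure
  of its interior.\<close>

lemma pure_complex_interior_meets:
  fixes A :: "'a::euclidean_space set set"
  assumes A: "pure_complex DIM('a) A" and x: "x \<in> \<Union>A" and N: "open N" "x \<in> N"
  shows "interior (\<Union>A) \<inter> N \<noteq> {}"
proof -
  obtain P Q where PQ: "x \<in> P" "Q \<in> A" "P face_of Q" "aff_dim Q = int DIM('a)"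
    using A x unfolding pure_complex_def by (metis UnionE)
  have cQ: "convex Q" using A PQ(2) by (auto simp: pure_complex_def polytopal_complex_def polytope_imp_convex)
  have "x \<in> closure (interior Q)"
    using convex_closure_interior[OF cQ convex_full_dim_interior[OF cQ PQ(4)]] PQ closure_subset
      face_of_imp_subset by blast
  then have "N \<inter> interior Q \<noteq> {}" using N by (metis IntI closure_iff_nhds_not_empty interior_subset open_Int_closure_eq_empty emptyE)
  moreover have "interior Q \<subseteq> interior (\<Union>A)" using PQ(2) by (intro interior_mono) blast
  ultimately show ?thesis by blast
qed

lemma polytopal_complex_Int:
  assumes "polytopal_complex A" "polytopal_complex B"
  shows "polytopal_complex (A \<inter> B)"
  using assms unfolding polytopal_complex_def by (metis IntD1 IntD2 IntI finite_Int)

lemma boundary_cell_aff_dim: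
  fixes K :: "'a::euclidean_space set set"
  assumes K: "polytopal_complex K" and F: "F \<in> boundary_complex K"
  shows "aff_dim F < int DIM('a)"
  using assms polytope_imp_convex polytopal_complexD(2)[OF K]
  by (intro aff_dim_less_if_subset_frontier[of F "\<Union>K"]) (auto simp: boundary_complex_def)

text \<open>Inside \<open>N\<close> the two boundaries are \<open>\<Union>(A \<inter> B)\<close>, so around a point of a glued facet \<open>A\<close> and \<open>B\<close>
  fill the two sides of its hyperplane. Hence the frontier of \<open>\<Union>A \<union> \<Union>B\<close> has codimension at least two
  within \<open>N\<close>; a segment in general position avoids it.\<close>

lemma glued_ball_subset:
  fixes A B :: "'a::euclidean_space set set"
  assumes A: "pure_complex DIM('a) A" and B: "pure_complex DIM('a) B"
    and AB: "\<Union>A \<inter> \<Union>B = \<Union>(A \<inter> B)"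
    and bd: "A \<inter> B \<subseteq> boundary_complex A" "A \<inter> B \<subseteq> boundary_complex B"
    and N: "convex N" "open N" and x: "x \<in> N" "x \<in> \<Union>A"
    and frA: "N \<inter> frontier (\<Union>A) \<subseteq> \<Union>(A \<inter> B)" and frB: "N \<inter> frontier (\<Union>B) \<subseteq> \<Union>(A \<inter> B)"
  shows "N \<subseteq> \<Union>A \<union> \<Union>B"
proof (rule ccontr)
  have pA: "polytopal_complex A" and pB: "polytopal_complex B" using A B by (auto simp: pure_complex_def)
  have pAB: "polytopal_complex (A \<inter> B)" by (rule polytopal_complex_Int[OF pA pB])
  have clA: "closed (\<Union>A)" and clB: "closed (\<Union>B)" using pA pB complex_closed by blast+
  define W where "W = \<Union>A \<union> \<Union>B"
  have clW: "closed W" unfolding W_def using clA clB by (rule closed_Un)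
  have facet: "z \<in> interior W" if z: "z \<in> N" "z \<in> rel_interior G" and G: "G \<in> A \<inter> B" "aff_dim G = int DIM('a) - 1" for z G
  proof -
    have "aff_dim G = int (DIM('a) - 1)" using G(2) DIM_positive[where 'a = 'a] by linarith
    then have "\<exists>a b. a \<noteq> 0 \<and> affine hull G = {y. a \<bullet> y = b}" by (rule iffD1[OF aff_dim_eq_hyperplane])
    then obtain a b where ab: "a \<noteq> 0" "affine hull G = {y. a \<bullet> y = b}" by (elim exE conjE)
    have zG: "z \<in> G" using z(2) rel_interior_subset by blast
    \<comment> \<open>Another glued cell through \<open>z\<close> would have \<open>G\<close> as a
      proper face and thus dimension \<open>d\<close>, too large for a boundary cell.\<close>
    have eq: "Q = G" if Q: "Q \<in> A \<inter> B" "z \<in> Q" for Q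
    proof (rule ccontr)
      assume "Q \<noteq> G"
      moreover have "G face_of Q" by (rule polytopal_complex_rel_interior_mem[OF pAB G(1) Q(1) z(2) Q(2)])
      ultimately have "aff_dim G < aff_dim Q"
        using polytopal_complexD(2)[OF pAB Q(1)] by (intro face_of_aff_dim_lt) (auto simp: polytope_imp_convex)
      then show False using boundary_cell_aff_dim[OF pA] Q(1) bd(1) G(2) by fastforce
    qed
    have "closed (\<Union>(A \<inter> B - {G}))"
    proof (rule closed_Union)
      show "finite (A \<inter> B - {G})" using polytopal_complexD(1)[OF pAB] by (rule finite_Diff)
      show "\<forall>Q\<in>A \<inter> B - {G}. closed Q" using polytopal_complexD(2)[OF pAB] polytope_imp_closed by blast
    qed
    moreover have "z \<notin> \<Union>(A \<inter> B - {G})" using eq by blast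
    ultimately have "open (N - \<Union>(A \<inter> B - {G}))" "z \<in> N - \<Union>(A \<inter> B - {G})" using N(2) z(1) by auto
    then obtain e where e: "e > 0" "ball z e \<subseteq> N - \<Union>(A \<inter> B - {G})" using open_contains_ball by blast
    have flat: "ball z e \<inter> \<Union>(A \<inter> B) \<subseteq> {y. a \<bullet> y = b}"
      unfolding ab(2)[symmetric] using e(2) hull_subset[of G affine] by blast
    have "a \<bullet> z = b" using ab(2) hull_inc[OF zG, of affine] by auto
    have zA: "z \<in> \<Union>A" "z \<in> \<Union>B" using zG G(1) by auto
    have "ball z e \<subseteq> W"
      unfolding W_def
    proof (rule ball_subset_Un_two_sides[OF clA clB ab(1) \<open>a \<bullet> z = b\<close> e(1)])
      show "ball z e \<inter> frontier (\<Union>A) \<subseteq> {y. a \<bullet> y = b}" "ball z e \<inter> frontier (\<Union>B) \<subseteq> {y. a \<bullet> y = b}"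
        using flat frA frB e(2) by blast+
      show "ball z e \<inter> (\<Union>A \<inter> \<Union>B) \<subseteq> {y. a \<bullet> y = b}" using flat AB by simp
      show "interior (\<Union>A) \<inter> ball z e \<noteq> {}"
        using pure_complex_interior_meets[OF A zA(1) open_ball] e(1) by simp
      show "interior (\<Union>B) \<inter> ball z e \<noteq> {}"
        using pure_complex_interior_meets[OF B zA(2) open_ball] e(1) by simp
    qed
    then show ?thesis using e(1) by (metis centre_in_ball interior_maximal open_ball subsetD)
  qed
  define L where "L = {G \<in> A \<inter> B. aff_dim G \<le> int DIM('a) - 2}"
  \<comment> \<open>Such a point lies in the relative interior of some glued cell;
    \<open>facet\<close> excludes dimension \<open>d - 1\<close>.\<close>
  have low: "N \<inter> frontier W \<subseteq> \<Union>L"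
  proof
    fix z assume z: "z \<in> N \<inter> frontier W"
    then have "z \<in> W" using clW frontier_subset_closed by blast
    moreover have "z \<notin> interior (\<Union>A)" "z \<notin> interior (\<Union>B)"
      using z interior_mono[of "\<Union>A" W] interior_mono[of "\<Union>B" W] by (auto simp: frontier_def W_def)
    ultimately have "z \<in> frontier (\<Union>A) \<or> z \<in> frontier (\<Union>B)"
      using closure_subset[of "\<Union>A"] closure_subset[of "\<Union>B"] unfolding W_def frontier_def by blast
    then have "z \<in> \<Union>(A \<inter> B)" using frA frB z by blast
    then obtain G where G: "G \<in> A \<inter> B" "z \<in> rel_interior G" using complex_rel_interior_cover[OF pAB] by blast
    have "aff_dim G \<noteq> int DIM('a) - 1" using facet[OF _ G(2,1)] z by (auto simp: frontier_def)
    moreover have "aff_dim G < int DIM('a)" using boundary_cell_aff_dim[OF pA] G(1) bd(1) by blast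
    ultimately have "G \<in> L" using G(1) by (auto simp: L_def)
    then show "z \<in> \<Union>L" using G(2) rel_interior_subset by blast
  qed
  assume "\<not> N \<subseteq> \<Union>A \<union> \<Union>B"
  then have ne: "N - W \<noteq> {}" by (auto simp: W_def)
  obtain p where p: "p \<in> interior (\<Union>A)" "p \<in> N" using pure_complex_interior_meets[OF A x(2) N(2) x(1)] by blast
  have pW: "p \<in> interior W" using p(1) interior_mono[of "\<Union>A" W] by (auto simp: W_def)
  \<comment> \<open>The endpoints \<open>q\<close> to be avoided: a segment from \<open>p\<close>
    that meets \<open>G\<close> in a point other than \<open>p\<close> ends in the affine hull of
    \<open>p\<close> and \<open>G\<close>, which has dimension at most \<open>d - 1\<close>.\<close>
  have "negligible (\<Union>G\<in>L. affine hull insert p G)"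
  proof (rule negligible_Union)
    show "finite ((\<lambda>G. affine hull insert p G) ` L)"
      using finite_subset[OF _ polytopal_complexD(1)[OF pAB], of L] by (auto simp: L_def)
    show "negligible T" if T: "T \<in> (\<lambda>G. affine hull insert p G) ` L" for T
    proof -
      obtain G where G: "G \<in> L" "T = affine hull insert p G" using T by blast
      have "aff_dim T \<le> int DIM('a) - 1"
        using G aff_dim_insert[of p G] by (auto simp: L_def split: if_splits)
      then have "interior T = {}" using affine_hull_nonempty_interior[of T] aff_dim_eq_full[of T] by force
      then show ?thesis using G(2) negligible_convex_interior[of T] by (simp add: affine_imp_convex)
    qed
  qed
  moreover have "open (N - W)" using N(2) clW by (rule open_Diff)
  ultimately have "\<not> N - W \<subseteq> (\<Union>G\<in>L. affine hull insert p G)"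
    using open_not_negligible[OF _ ne] negligible_subset by blast
  then obtain q where q: "q \<in> N" "q \<notin> W" "\<And>G. G \<in> L \<Longrightarrow> q \<notin> affine hull insert p G" by blast
  have "closed_segment p q \<inter> frontier W \<noteq> {}"
    using pW interior_subset q(2) by (intro connected_Int_frontier) auto
  then obtain z where z: "z \<in> closed_segment p q" "z \<in> frontier W" by blast
  have "closed_segment p q \<subseteq> N" using N(1) p(2) q(1) by (rule closed_segment_subset[rotated 2])
  then obtain G where G: "G \<in> L" "z \<in> G" using low z by blast
  have "z \<noteq> p" using pW z(2) by (auto simp: frontier_def)
  obtain u where u: "z = (1 - u) *\<^sub>R p + u *\<^sub>R q" using z(1) by (auto simp: in_segment)
  then have "u \<noteq> 0" using \<open>z \<noteq> p\<close> by auto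
  \<comment> \<open>Solving for the endpoint puts \<open>q\<close> on the line through
    \<open>p\<close> and \<open>z\<close>, hence into the excluded hull.\<close>
  have "q = (1 - 1 / u) *\<^sub>R p + (1 / u) *\<^sub>R z"
  proof -
    have "(1 / u) *\<^sub>R z = ((1 - u) / u) *\<^sub>R p + q"
      using \<open>u \<noteq> 0\<close> unfolding u by (simp add: scaleR_add_right)
    moreover have "1 - 1 / u = - ((1 - u) / u)" using \<open>u \<noteq> 0\<close> by (simp add: divide_simps)
    ultimately show ?thesis by simp
  qed
  moreover have "p \<in> affine hull insert p G" "z \<in> affine hull insert p G" using G(2) by (simp_all add: hull_inc)
  ultimately have "q \<in> affine hull insert p G"
    using mem_affine[OF affine_affine_hull, of p "insert p G" z "1 - 1 / u" "1 / u"] by simp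
  then show False using q(3) G(1) by blast
qed

text \<open>The place where the absence of boundary enters: \<open>U\<close> is open in both
  frontiers, so a small ball around \<open>x\<close> meets each frontier only within
  \<open>U\<close>, hence within the glued cells.\<close>

lemma glued_cell_interior:
  fixes A B :: "'a::euclidean_space set set"
  assumes A: "pure_complex DIM('a) A" and B: "pure_complex DIM('a) B"
    and AB: "\<Union>A \<inter> \<Union>B = \<Union>(A \<inter> B)"
    and bd: "A \<inter> B \<subseteq> boundary_complex A" "A \<inter> B \<subseteq> boundary_complex B"
    and closed: "gluing_boundary A B = {}" and x: "x \<in> \<Union>(A \<inter> B)"
  shows "x \<in> interior (\<Union>A \<union> \<Union>B)"
proof -
  have pA: "polytopal_complex A" and pB: "polytopal_complex B" using A B by (auto simp: pure_complex_def)
  have "x \<in> gluing_interior A B" using closed x by (auto simp: gluing_boundary_def)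
  then obtain U where U: "x \<in> U" "U \<subseteq> \<Union>(A \<inter> B)"
    "openin (top_of_set (frontier (\<Union>A))) U" "openin (top_of_set (frontier (\<Union>B))) U"
    unfolding gluing_interior_def Union_boundary_complex[OF pA] Union_boundary_complex[OF pB] by blast
  obtain V where V: "open V" "U = frontier (\<Union>A) \<inter> V" using U(3) openin_open by metis
  obtain V' where V': "open V'" "U = frontier (\<Union>B) \<inter> V'" using U(4) openin_open by metis
  obtain e where e: "e > 0" "ball x e \<subseteq> V \<inter> V'"
    using open_contains_ball[of "V \<inter> V'"] V V' U(1) by blast
  have "ball x e \<subseteq> \<Union>A \<union> \<Union>B"
    by (rule glued_ball_subset[OF A B AB bd, of _ x]) (use e x U(2) V(2) V'(2) in auto)
  then show ?thesis using e(1) by (metis centre_in_ball interior_maximal open_ball subsetD)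
qed

lemma glued_boundary_complex:
  fixes A B C :: "'a::euclidean_space set set"
  assumes glue: "gluing C A B" and closed: "gluing_boundary A B = {}"
  shows "boundary_complex C - {{}} = (boundary_complex A - B - {{}}) \<union> (boundary_complex B - A - {{}})"
    and "\<And>F. F \<in> boundary_complex A - B - {{}} \<Longrightarrow> solid_angle F C = solid_angle F A"
    and "\<And>F. F \<in> boundary_complex B - A - {{}} \<Longrightarrow> solid_angle F C = solid_angle F B"
    and "\<And>F. F \<in> A \<inter> B - {{}} \<Longrightarrow> solid_angle F A + solid_angle F B = 1"
proof -
  have pureA: "pure_complex DIM('a) A" and pureB: "pure_complex DIM('a) B" and pureC: "pure_complex DIM('a) C"
    and C: "C = A \<union> B" and AB: "\<Union>A \<inter> \<Union>B = \<Union>(A \<inter> B)"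
    and bd: "A \<inter> B \<subseteq> boundary_complex A" "A \<inter> B \<subseteq> boundary_complex B"
    using glue by (auto simp: gluing_def geometric_complex_def)
  have pA: "polytopal_complex A" and pB: "polytopal_complex B" and pC: "polytopal_complex C"
    using pureA pureB pureC by (auto simp: pure_complex_def)
  have relint: "\<exists>x. x \<in> rel_interior F" if "F \<in> C" "F \<noteq> {}" for F
    using rel_interior_eq_empty[of F] polytope_imp_convex[OF polytopal_complexD(2)[OF pC that(1)]] that(2) by blast
  \<comment> \<open>Symmetric in form, so that it applies to \<open>A\<close> against
    \<open>B\<close> and to \<open>B\<close> against \<open>A\<close>.\<close>
  have free: "(F \<in> boundary_complex C \<longleftrightarrow> F \<in> boundary_complex K) \<and> solid_angle F C = solid_angle F K"
    if K: "polytopal_complex K" and L: "polytopal_complex L" and KL: "C = K \<union> L" "\<Union>K \<inter> \<Union>L = \<Union>(K \<inter> L)"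
      and F: "F \<in> K" "F \<notin> L" "F \<noteq> {}" for F K L
  proof -
    have FC: "F \<in> C" using F(1) KL(1) by blast
    then obtain x where x: "x \<in> rel_interior F" using relint F(3) by blast
    \<comment> \<open>Points common to both complexes lie in a common cell; it would have
      \<open>F\<close> as a face, and closure under faces would put \<open>F\<close> into
      \<open>L\<close>.\<close>
    have "x \<notin> \<Union>L"
    proof
      assume "x \<in> \<Union>L"
      moreover have "x \<in> \<Union>K" using x F(1) rel_interior_subset by blast
      ultimately obtain G where G: "G \<in> K" "G \<in> L" "x \<in> G" using KL(2) by blast
      then have "F face_of G" using polytopal_complex_rel_interior_mem[OF K F(1) G(1) x] by blast
      then show False using polytopal_complexD(3)[OF L G(2)] F(2) by blast
    qed
    then have U: "open (- \<Union>L)" "x \<in> - \<Union>L" "\<Union>C \<inter> - \<Union>L = \<Union>K \<inter> - \<Union>L"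
      using complex_closed[OF L] KL(1) by auto
    have "locally_eq x (\<Union>C) x (\<Union>K)"
    proof -
      obtain e where e: "e > 0" "ball x e \<subseteq> - \<Union>L" using U(1,2) open_contains_ball by blast
      show ?thesis
      proof (rule locally_eq_ballI[OF e(1)])
        fix v :: 'a assume "norm v < e"
        then have "x + v \<in> - \<Union>L" using e(2) by (auto simp: dist_norm subset_iff)
        then show "x + v \<in> \<Union>C \<longleftrightarrow> x + v \<in> \<Union>K" using U(3) by blast
      qed
    qed
    then show ?thesis
      using boundary_complex_iff[OF pC FC x] boundary_complex_iff[OF K F(1) x] locally_eq_frontier
        solid_angle_cong[OF pC FC K F(1) x U] by blast
  qed
  have freeA: "(F \<in> boundary_complex C \<longleftrightarrow> F \<in> boundary_complex A) \<and> solid_angle F C = solid_angle F A"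
    if "F \<in> A" "F \<notin> B" "F \<noteq> {}" for F
    using free[OF pA pB C AB] that by blast
  have freeB: "(F \<in> boundary_complex C \<longleftrightarrow> F \<in> boundary_complex B) \<and> solid_angle F C = solid_angle F B"
    if "F \<in> B" "F \<notin> A" "F \<noteq> {}" for F
    using free[OF pB pA, of F] that C AB by (simp add: Un_commute Int_commute)
  have UC: "\<Union>C = \<Union>A \<union> \<Union>B" using C by blast
  have glued: "x \<in> interior (\<Union>C)" if "F \<in> A \<inter> B" "x \<in> rel_interior F" for F x
    unfolding UC using that rel_interior_subset
    by (intro glued_cell_interior[OF pureA pureB AB bd closed]) blast
  have inner: "F \<notin> boundary_complex C" if F: "F \<in> A \<inter> B" "F \<noteq> {}" for F
  proof -
    have FC: "F \<in> C" using F(1) C by blast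
    then obtain x where x: "x \<in> rel_interior F" using relint F(2) by blast
    then show ?thesis using glued[OF F(1) x] boundary_complex_iff[OF pC FC x] by (simp add: frontier_def)
  qed
  have bdsub: "boundary_complex K \<subseteq> K" for K :: "'a set set" by (auto simp: boundary_complex_def)
  show "boundary_complex C - {{}} = (boundary_complex A - B - {{}}) \<union> (boundary_complex B - A - {{}})"
    using freeA freeB inner C bdsub[of A] bdsub[of B] bdsub[of C] by blast
  show "solid_angle F C = solid_angle F A" if "F \<in> boundary_complex A - B - {{}}" for F
    using freeA that bdsub[of A] by blast
  show "solid_angle F C = solid_angle F B" if "F \<in> boundary_complex B - A - {{}}" for F
    using freeB that bdsub[of B] by blast
  show "solid_angle F A + solid_angle F B = 1" if F: "F \<in> A \<inter> B - {{}}" for F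
  proof -
    have FAB: "F \<in> A" "F \<in> B" "F \<in> C" "F \<noteq> {}" using F C by auto
    obtain x where x: "x \<in> rel_interior F" using relint[OF FAB(3,4)] by blast
    \<comment> \<open>The two sets meet only in glued cells, which lie on the frontier of
      \<open>\<Union>A\<close>.\<close>
    have "interior (\<Union>A) \<inter> interior (\<Union>B) = {}"
    proof -
      have "\<Union>(A \<inter> B) \<subseteq> frontier (\<Union>A)" using bd(1) by (auto simp: boundary_complex_def)
      then show ?thesis using AB interior_subset[of "\<Union>A"] interior_subset[of "\<Union>B"] unfolding frontier_def by blast
    qed
    then show ?thesis
      using solid_angle_add[OF pA FAB(1) pB FAB(2) x] glued[OF _ x] FAB UC by auto
  qed
qed

section \<open>Weighted sums over boundary cells\<close>

text \<open>The weight \<open>g\<close> may depend on the complex, so that signs and signed angles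
  are both instances. A glued cell is counted once for \<open>A\<close> and once for
  \<open>B\<close> but not for \<open>C\<close>; its correction is twice the sign in the first
  instance and the sign in the second.\<close>

lemma sum_boundary_complex_glued:
  fixes A B C :: "'a::euclidean_space set set" and g :: "'a set set \<Rightarrow> 'a set \<Rightarrow> 'b::comm_ring_1"
  assumes glue: "gluing C A B" and closed: "gluing_boundary A B = {}"
    and gA: "\<And>F. F \<in> boundary_complex A - B - {{}} \<Longrightarrow> g C F = g A F"
    and gB: "\<And>F. F \<in> boundary_complex B - A - {{}} \<Longrightarrow> g C F = g B F"
  shows "(\<Sum>F\<in>boundary_complex C - {{}}. g C F) = (\<Sum>F\<in>boundary_complex A - {{}}. g A F)
    + (\<Sum>F\<in>boundary_complex B - {{}}. g B F) - (\<Sum>F\<in>A \<inter> B - {{}}. g A F + g B F)"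
proof -
  have fin: "finite A" "finite B"
    using glue by (auto simp: gluing_def geometric_complex_def pure_complex_def polytopal_complex_def)
  have bd: "A \<inter> B \<subseteq> boundary_complex A" "A \<inter> B \<subseteq> boundary_complex B"
    using glue by (auto simp: gluing_def)
  have bdsub: "boundary_complex K \<subseteq> K" for K :: "'a set set" by (auto simp: boundary_complex_def)
  have finbd: "finite (boundary_complex A)" "finite (boundary_complex B)"
    using fin bdsub finite_subset by blast+
  have "boundary_complex A - {{}} = (boundary_complex A - B - {{}}) \<union> (A \<inter> B - {{}})"
    using bd(1) bdsub[of A] by blast
  then have 1: "(\<Sum>F\<in>boundary_complex A - {{}}. g A F)
      = (\<Sum>F\<in>boundary_complex A - B - {{}}. g A F) + (\<Sum>F\<in>A \<inter> B - {{}}. g A F)"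
    using fin finbd by (simp add: sum.union_disjoint disjoint_iff)
  have "boundary_complex B - {{}} = (boundary_complex B - A - {{}}) \<union> (A \<inter> B - {{}})"
    using bd(2) bdsub[of B] by blast
  then have 2: "(\<Sum>F\<in>boundary_complex B - {{}}. g B F)
      = (\<Sum>F\<in>boundary_complex B - A - {{}}. g B F) + (\<Sum>F\<in>A \<inter> B - {{}}. g B F)"
    using fin finbd by (simp add: sum.union_disjoint disjoint_iff)
  have "(boundary_complex A - B - {{}}) \<inter> (boundary_complex B - A - {{}}) = {}" using bdsub by blast
  then have "(\<Sum>F\<in>boundary_complex C - {{}}. g C F)
      = (\<Sum>F\<in>boundary_complex A - B - {{}}. g C F) + (\<Sum>F\<in>boundary_complex B - A - {{}}. g C F)"
    unfolding glued_boundary_complex(1)[OF glue closed] using finbd by (intro sum.union_disjoint) auto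
  also have "\<dots> = (\<Sum>F\<in>boundary_complex A - B - {{}}. g A F) + (\<Sum>F\<in>boundary_complex B - A - {{}}. g B F)"
    using gA gB by simp
  finally show ?thesis unfolding 1 2 by (simp add: sum.distrib)
qed

lemma boundary_characteristics:
  fixes K :: "'a::euclidean_space set set"
  assumes K: "polytopal_complex K"
  shows "euler_char (boundary_complex K) = (\<Sum>F\<in>boundary_complex K - {{}}. (-1) ^ nat (aff_dim F))"
    and "angle_char K = (\<Sum>F\<in>boundary_complex K - {{}}. (-1) ^ nat (aff_dim F) * solid_angle F K)"
proof -
  have fin: "finite (boundary_complex K)"
    using polytopal_complexD(1)[OF K] by (simp add: boundary_complex_def)
  show "euler_char (boundary_complex K) = (\<Sum>F\<in>boundary_complex K - {{}}. (-1) ^ nat (aff_dim F))"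
    by (rule euler_char_eq_sum[OF fin boundary_cell_aff_dim[OF K]])
  show "angle_char K = (\<Sum>F\<in>boundary_complex K - {{}}. (-1) ^ nat (aff_dim F) * solid_angle F K)"
    unfolding angle_char_def angle_sum_def
    by (rule alternating_sum_faces_of_dim[OF fin boundary_cell_aff_dim[OF K]])
qed

lemma characteristics_glued:
  fixes A B C :: "'a::euclidean_space set set"
  assumes glue: "gluing C A B" and closed: "gluing_boundary A B = {}"
  shows "euler_char (boundary_complex C)
      = euler_char (boundary_complex A) + euler_char (boundary_complex B) - 2 * euler_char (A \<inter> B)"
    and "angle_char C = angle_char A + angle_char B - real_of_int (euler_char (A \<inter> B))"
proof -
  have p: "polytopal_complex A" "polytopal_complex B" "polytopal_complex C" and bd: "A \<inter> B \<subseteq> boundary_complex A"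
    using glue by (auto simp: gluing_def geometric_complex_def pure_complex_def)
  have ec: "euler_char (A \<inter> B) = (\<Sum>F\<in>A \<inter> B - {{}}. (-1) ^ nat (aff_dim F))"
    using polytopal_complexD(1)[OF p(1)] boundary_cell_aff_dim[OF p(1)] bd by (intro euler_char_eq_sum) auto
  show "euler_char (boundary_complex C)
      = euler_char (boundary_complex A) + euler_char (boundary_complex B) - 2 * euler_char (A \<inter> B)"
    using sum_boundary_complex_glued[OF glue closed, of "\<lambda>_ F. (-1) ^ nat (aff_dim F) :: int"]
    by (simp add: boundary_characteristics(1)[OF p(1)] boundary_characteristics(1)[OF p(2)]
        boundary_characteristics(1)[OF p(3)] ec sum_distrib_left)
  let ?g = "\<lambda>K F. (-1) ^ nat (aff_dim F) * solid_angle F K"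
  have "(\<Sum>F\<in>A \<inter> B - {{}}. ?g A F + ?g B F) = (\<Sum>F\<in>A \<inter> B - {{}}. (-1) ^ nat (aff_dim F))"
    using glued_boundary_complex(4)[OF glue closed] by (intro sum.cong) (simp_all flip: distrib_left)
  then have "(\<Sum>F\<in>A \<inter> B - {{}}. ?g A F + ?g B F) = real_of_int (euler_char (A \<inter> B))"
    by (simp add: ec)
  then show "angle_char C = angle_char A + angle_char B - real_of_int (euler_char (A \<inter> B))"
    using sum_boundary_complex_glued[OF glue closed, of ?g] glued_boundary_complex(2,3)[OF glue closed]
    by (simp add: boundary_characteristics(2)[OF p(1)] boundary_characteristics(2)[OF p(2)]
        boundary_characteristics(2)[OF p(3)])
qed

text \<open>Without the empty cell, which all components share, the components have no cell in
  common, so their Euler characteristics add up.\<close>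

lemma euler_char_disjoint_spheres:
  fixes S :: "'a::euclidean_space set set"
  assumes "union_of_disjoint_spheres m S"
  shows "euler_char S = int m * (1 + (-1) ^ (DIM('a) - 1))"
proof -
  obtain \<D> where D: "finite \<D>" "S = \<Union>\<D>" "\<And>D. D \<in> \<D> \<Longrightarrow> pure_complex (DIM('a) - 1) D"
    "pairwise (\<lambda>D E. \<Union>D \<inter> \<Union>E = {}) \<D>" "card \<D> = m" "\<And>D. D \<in> \<D> \<Longrightarrow> \<Union>D homeomorphic sphere (0::'a) 1"
    using assms unfolding union_of_disjoint_spheres_def disjoint_union_of_complexes_def by blast
  have fin: "finite D" if "D \<in> \<D>" for D
    using D(3)[OF that] by (simp add: pure_complex_def polytopal_complex_def)
  have dim: "aff_dim F < int DIM('a)" if "D \<in> \<D>" "F \<in> D" for D F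
    using pure_complex_aff_dim_le[OF D(3)[OF that(1)] that(2)] DIM_positive[where 'a = 'a] by linarith
  have "euler_char S = (\<Sum>F\<in>S - {{}}. (-1) ^ nat (aff_dim F))"
    using D(1,2) fin dim by (intro euler_char_eq_sum) auto
  also have "S - {{}} = (\<Union>D\<in>\<D>. D - {{}})" using D(2) by blast
  also have "(\<Sum>F\<in>(\<Union>D\<in>\<D>. D - {{}}). (-1) ^ nat (aff_dim F)) = (\<Sum>D\<in>\<D>. \<Sum>F\<in>D - {{}}. (-1) ^ nat (aff_dim F) :: int)"
  proof (rule sum.UNION_disjoint)
    show "\<forall>D\<in>\<D>. \<forall>E\<in>\<D>. D \<noteq> E \<longrightarrow> (D - {{}}) \<inter> (E - {{}}) = {}"
    proof (intro ballI impI)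
      fix D E assume "D \<in> \<D>" "E \<in> \<D>" "D \<noteq> E"
      then have "\<Union>D \<inter> \<Union>E = {}" using D(4) by (auto simp: pairwise_def)
      then show "(D - {{}}) \<inter> (E - {{}}) = {}" by blast
    qed
  qed (use D(1) fin in auto)
  also have "\<dots> = (\<Sum>D\<in>\<D>. euler_char D)"
    using fin dim by (intro sum.cong euler_char_eq_sum[symmetric]) auto
  also have "\<dots> = (\<Sum>D\<in>\<D>. 1 + (-1) ^ (DIM('a) - 1))"
    using euler_char_sphere D(3,6) by (intro sum.cong) auto
  also have "\<dots> = int m * (1 + (-1) ^ (DIM('a) - 1))" using D(5) by simp
  finally show ?thesis .
qed

text \<open>Both equations of \<open>characteristics_glued\<close> contain the same number
  \<open>euler_char (A \<inter> B)\<close>: eliminating it gives the general identity, inserting its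
  value for spheres gives the two special ones.\<close>

theorem theorem3p3p6:
  fixes A B C :: "'a::euclidean_space set set"
  assumes "gluing C A B"
    and "\<exists>\<D>. disjoint_union_of_complexes (A \<inter> B) \<D>"
    and "gluing_boundary A B = {}"
  shows "real_of_int (euler_char (boundary_complex C) - euler_char (boundary_complex A)
             - euler_char (boundary_complex B))
           = 2 * (angle_char C - angle_char A - angle_char B)
         \<and> (\<forall>m. union_of_disjoint_spheres m (A \<inter> B) \<longrightarrow>
              euler_char (boundary_complex C)
                = euler_char (boundary_complex A) + euler_char (boundary_complex B)
                  - 2 * int m * (1 + (-1) ^ (DIM('a) - 1))
              \<and> angle_char C
                = angle_char A + angle_char B - real m * (1 + (-1) ^ (DIM('a) - 1)))"
  using characteristics_glued[OF assms(1,3)] euler_char_disjoint_spheres[of _ "A \<inter> B"] by simp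

end
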